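(* Let $q$ be a prime power and $b\geq 2$ an integer. Put \[a_J = \frac{8}{3}\left(\frac{bq^b}{q^b-1}\,2^b(2q^b)^b q^{b^2}\right)^{q^b/b},\qquad M_{q^b}= \left(\frac{\max\{b-1,\, q^b/b\}}{ \log (3/4)}\right)^2 .\] Then for all integers $c > M_{q^b}$, \[\left|\frac{|\mathrm{pcb}(c,q^b)|}{|\mathrm{M}(c,q^b)|}- \lim_{c'\to\infty}\frac{|\mathrm{pcb}(c',q^b)|}{|\mathrm{M}(c',q^b)|}\right| \leq \frac{a_J}{1-q^{-b}}\, q^{-bc}.\]
   Context: Let $F=\mathrm{GF}(q)$, $K=\mathrm{GF}(q^b)$, $n=bc$. $\mathrm{M}(c,q^b)$ is the algebra of $c\times c$ matrices over $K$, acting on the space $K^c$ of row vectors. Regarding $K^c$ as an $n$-dimensional $F$-vector space $V_F$, each $X\in \mathrm{M}(c,q^b)$ acts as an $F$-linear endomorphism of $V_F$, denoted $X_F$. For an endomorphism $Y$ of a finite-dimensional $F$-space $V$ and a monic irreducible $f\in F[t]$, the $f$-primary component is $V_f=\ker f(Y)^{\dim V}$. $Y$ is $f$-primary cyclic if $V_f\neq 0$ and the minimal polynomial of $Y|_{V_f}$ equals its characteristic polynomial. $\mathrm{pcb}(c,q^b)$ is the set of $X\in\mathrm{M}(c,q^b)$ such that $X_F$ is $f$-primary cyclic for some monic irreducible $f\in F[t]$ of degree $b$. The limit in the statement exists. $\log$ is the natural logarithm. *)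

theory Defs
  imports
    "HOL-Analysis.Analysis"
    "HOL-Number_Theory.Prime_Powers"
    "Jordan_Normal_Form.VS_Connect"
    "Jordan_Normal_Form.Char_Poly"
begin

section \<open>Endomorphisms of finite-dimensional vector spaces\<close>

text \<open>A vector space over the field \<open>'f\<close> is a record \<open>V\<close> with \<open>vectorspace class_ring V\<close>; an
  endomorphism is a function on its elements, of which only the values on \<open>carrier V\<close> matter.
  A subspace \<open>W\<close> is made into a space by \<open>V\<lparr>carrier := W\<rparr>\<close>.\<close>

definition poly_endo ::
    "('f::field, 'v) module \<Rightarrow> 'f poly \<Rightarrow> ('v \<Rightarrow> 'v) \<Rightarrow> 'v \<Rightarrow> 'v" where
  "poly_endo V p Y v = finsum V (\<lambda>i. Polynomial.coeff p i \<odot>\<^bsub>V\<^esub> (Y ^^ i) v) {..Polynomial.degree p}"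

definition min_poly_endo :: "('f::field, 'v) module \<Rightarrow> ('v \<Rightarrow> 'v) \<Rightarrow> 'f poly" where
  "min_poly_endo V Y = (THE p. monic p \<and> (\<forall>v\<in>carrier V. poly_endo V p Y v = \<zero>\<^bsub>V\<^esub>) \<and>
     (\<forall>r. (\<forall>v\<in>carrier V. poly_endo V r Y v = \<zero>\<^bsub>V\<^esub>) \<longrightarrow> p dvd r))"

definition ordered_basis :: "('f::field, 'v) module \<Rightarrow> 'v list \<Rightarrow> bool" where
  "ordered_basis V bs \<longleftrightarrow> distinct bs \<and> vectorspace.basis class_ring V (set bs)"

definition represents ::
    "('f::field, 'v) module \<Rightarrow> 'v list \<Rightarrow> 'f mat \<Rightarrow> ('v \<Rightarrow> 'v) \<Rightarrow> bool" where
  "represents V bs A Y \<longleftrightarrow> A \<in> carrier_mat (length bs) (length bs) \<and>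
     (\<forall>j<length bs. Y (bs ! j) = finsum V (\<lambda>i. (A $$ (i, j)) \<odot>\<^bsub>V\<^esub> (bs ! i)) {..<length bs})"

text \<open>The matrices representing \<open>Y\<close> in the various bases are similar, so the choice is
  immaterial.\<close>

definition char_poly_endo :: "('f::field, 'v) module \<Rightarrow> ('v \<Rightarrow> 'v) \<Rightarrow> 'f poly" where
  "char_poly_endo V Y = char_poly (SOME A. \<exists>bs. ordered_basis V bs \<and> represents V bs A Y)"

definition primary_component ::
    "('f::field, 'v) module \<Rightarrow> 'f poly \<Rightarrow> ('v \<Rightarrow> 'v) \<Rightarrow> 'v set" where
  "primary_component V f Y =
     {v \<in> carrier V. (poly_endo V f Y ^^ vectorspace.dim class_ring V) v = \<zero>\<^bsub>V\<^esub>}"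

definition primary_cyclic :: "('f::field, 'v) module \<Rightarrow> 'f poly \<Rightarrow> ('v \<Rightarrow> 'v) \<Rightarrow> bool" where
  "primary_cyclic V f Y \<longleftrightarrow>
     primary_component V f Y \<noteq> {\<zero>\<^bsub>V\<^esub>} \<and>
     min_poly_endo (V\<lparr>carrier := primary_component V f Y\<rparr>) Y =
     char_poly_endo (V\<lparr>carrier := primary_component V f Y\<rparr>) Y"

section \<open>Matrices over an extension field\<close>

text \<open>The extension of \<open>F\<close> by \<open>K\<close> is given by a homomorphism \<open>h\<close> from the field \<open>'f\<close> to the
  field \<open>'k\<close>.\<close>

definition restrict_scalars :: "('f \<Rightarrow> 'k) \<Rightarrow> ('k, 'v) module \<Rightarrow> ('f, 'v) module" where
  "restrict_scalars h V =
     \<lparr>carrier = carrier V, mult = mult V, one = one V, zero = zero V, add = add V,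
      smult = (\<lambda>a v. h a \<odot>\<^bsub>V\<^esub> v)\<rparr>"

text \<open>The action of a matrix on row vectors, \<open>v \<mapsto> v X\<close>.\<close>

definition row_action :: "'k::field mat \<Rightarrow> 'k vec \<Rightarrow> 'k vec" where
  "row_action X v = transpose_mat X *\<^sub>v v"

definition pcb :: "('f::field \<Rightarrow> 'k::field) \<Rightarrow> nat \<Rightarrow> nat \<Rightarrow> 'k mat set" where
  "pcb h b c = {X \<in> carrier_mat c c. \<exists>f :: 'f poly. monic f \<and> irreducible f \<and> Polynomial.degree f = b \<and>
     primary_cyclic (restrict_scalars h (module_vec TYPE('k) c)) f (row_action X)}"

definition pcb_proportion :: "('f::field \<Rightarrow> 'k::field) \<Rightarrow> nat \<Rightarrow> nat \<Rightarrow> real" where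
  "pcb_proportion h b c =
     real (card (pcb h b c)) / real (card (carrier_mat c c :: 'k mat set))"

definition a_J :: "nat \<Rightarrow> nat \<Rightarrow> real" where
  "a_J q b = 8 / 3 *
     (real b * real q ^ b / (real q ^ b - 1) * 2 ^ b * (2 * real q ^ b) ^ b * real q ^ (b\<^sup>2))
       powr (real q ^ b / real b)"

definition M_bound :: "nat \<Rightarrow> nat \<Rightarrow> real" where
  "M_bound q b = (max (real b - 1) (real q ^ b / real b) / ln (3 / 4))\<^sup>2"

section \<open>Well-definedness\<close>

lemma vectorspace_restrict_scalars:
  fixes h :: "'f::field \<Rightarrow> 'k::field"
  assumes "field_hom h"
  shows "vectorspace class_ring (restrict_scalars h (module_vec TYPE('k) c))"
proof -
  interpret field_hom h by fact
  show ?thesis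
    by unfold_locales
       (auto simp: restrict_scalars_def module_vec_simps class_ring_simps Units_def hom_distribs
          add_smult_distrib_vec smult_add_distrib_vec smult_smult_assoc intro!: bexI[of _ "- _"])
qed

lemma row_action_hom:
  fixes h :: "'f::field \<Rightarrow> 'k::field" and X :: "'k mat"
  assumes "X \<in> carrier_mat c c"
  defines "V \<equiv> restrict_scalars h (module_vec TYPE('k) c)"
  shows "row_action X \<in> module_hom class_ring V V"
  using assms
  by (auto simp: V_def module_hom_def restrict_scalars_def module_vec_simps row_action_def
      mult_add_distrib_mat_vec[of _ c c] mult_mat_vec[of _ c c])

end

theory Submission
  imports Defs
begin

text \<open>Write \<open>q\<close> for the size of the small field \<open>F\<close> and \<open>Q = q ^ b\<close> for that of the large field \<open>K\<close>.

  Membership in \<open>pcb\<close> is a condition on the sizes of eigenspaces over \<open>K\<close>.  For an endomorphism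
  \<open>Y\<close> over \<open>F\<close> and \<open>f\<close> irreducible of degree \<open>b\<close>, comparing the kernels of successive powers of \<open>f(Y)\<close>
  shows that \<open>Y\<close> is \<open>f\<close>-primary cyclic exactly when the kernel of \<open>f(Y)\<close> has \<open>q ^ b\<close> elements
  (\<open>primary_cyclic_iff_card_ker\<close>).  Since \<open>f\<close> splits over \<open>K\<close> into \<open>b\<close> distinct linear factors, that
  kernel is the direct sum of the eigenspaces of the matrix at the roots of \<open>f\<close>; hence the matrix is
  in \<open>pcb\<close> iff for some \<open>f\<close> exactly one root of \<open>f\<close> is an eigenvalue, with an eigenspace of
  dimension one (\<open>pcb_iff\<close>).  The root sets of the polynomials \<open>f\<close> are disjoint subsets of \<open>K\<close> of
  size \<open>b\<close>, so there are at most \<open>Q / b\<close> of them.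

  The dimensions of the eigenspaces of a uniformly random matrix have explicit joint factorial moments.
  Counting pairs of a matrix and an independent list of eigenvectors with prescribed eigenvalues
  shows that the average of \<open>\<Prod>\<mu>. (\<Prod>i<e \<mu>. x \<mu> - Q ^ i)\<close>, where \<open>x \<mu>\<close> is the size of the
  eigenspace at \<open>\<mu>\<close>, is \<open>\<Prod>i<k. 1 - Q ^ i / Q ^ c\<close> with \<open>k\<close> the sum of the \<open>e \<mu>\<close>
  (\<open>joint_factorial_moment\<close>).  It depends on the size \<open>c\<close> of the matrices only by an error of
  \<open>Q ^ k / Q ^ c\<close>.  The indicators of \<open>x = 1\<close> and \<open>x = Q\<close> have Newton expansions at the nodes
  \<open>Q ^ i\<close> whose coefficients do not depend on \<open>c\<close> and are so small that they remain summable, with sum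
  at most \<open>16/3\<close>, after multiplication by \<open>Q ^ e\<close>.  So the proportion of matrices with prescribed
  eigenspaces of dimension 0 or 1 at the points of a set \<open>T\<close> varies with the size, from \<open>c\<close> on, by at
  most \<open>(16/3) ^ card T / Q ^ c\<close> (\<open>density_prescribed_diff\<close>).

  The proportion of matrices outside \<open>pcb\<close> is a signed sum of such proportions.  Removing one root set
  after the other multiplies the error constant by \<open>1 + b * (16/3) ^ b\<close> each time
  (\<open>density_prescribed_family_diff\<close>).  Hence the proportions form a Cauchy sequence with error
  \<open>(1 + b * (16/3) ^ b) ^ N / Q ^ c\<close> where \<open>N \<le> Q / b\<close>, and \<open>a_J\<close> is at least this constant
 
  (\<open>error_constant_le_a_J\<close>).\<close>
section \<open>Polynomials over a field\<close>

lemma card_field_gt_1: "CARD('k::{field,finite}) > 1"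
  using card_mono[of UNIV "{0, 1 :: 'k}"] by simp

lemma card_poly_degree_less:
  assumes "b > 0"
  shows "card {r :: 'f::{field,finite} poly. degree r < b} = CARD('f) ^ b"
proof -
  have "bij_betw Poly {as :: 'f list. set as \<subseteq> UNIV \<and> length as = b} {r. degree r < b}"
  proof (rule bij_betwI[where g = "\<lambda>r. map (coeff r) [0..<b]"])
    show "Poly \<in> {as :: 'f list. set as \<subseteq> UNIV \<and> length as = b} \<rightarrow> {r. degree r < b}"
    proof (intro funcsetI CollectI)
      fix as :: "'f list" assume "as \<in> {as. set as \<subseteq> UNIV \<and> length as = b}"
      then have "degree (Poly as) \<le> b - 1"
        by (intro degree_le) (auto simp: nth_default_def)
      then show "degree (Poly as) < b" using assms by simp
    qed
    show "map (coeff (Poly as)) [0..<b] = as" if "as \<in> {as. set as \<subseteq> UNIV \<and> length as = b}" for as :: "'f list"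
      using that by (intro nth_equalityI) (auto simp: nth_default_def)
    show "Poly (map (coeff r) [0..<b]) = r" if "r \<in> {r. degree r < b}" for r :: "'f poly"
      using that by (auto simp: poly_eq_iff nth_default_def coeff_eq_0)
  qed auto
  from bij_betw_same_card[OF this] show ?thesis
    using card_lists_length_eq[of "UNIV :: 'f set" b] by simp
qed

text \<open>A nonzero combination of \<open>f\<close> and \<open>g\<close> of least degree divides both, so irreducibility makes it a
  constant.\<close>
lemma irreducible_bezout:
  fixes f g :: "'f::field poly"
  assumes f: "irreducible f" and g: "\<not> f dvd g"
  shows "\<exists>a b. a * g + b * f = 1"
proof -
  let ?I = "{p. p \<noteq> 0 \<and> (\<exists>a b. p = a * g + b * f)}"
  have "f = 0 * g + 1 * f" by simp
  moreover have "f \<noteq> 0" using f by auto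
  ultimately have "f \<in> ?I" by blast
  then obtain d where d: "d \<in> ?I" and min: "\<And>p. p \<in> ?I \<Longrightarrow> degree d \<le> degree p"
    using ex_has_least_nat[of "\<lambda>p. p \<in> ?I" f degree] by blast
  obtain a b where ab: "d = a * g + b * f" using d by blast
  have dvd: "d dvd s * g + t * f" for s t
  proof (rule ccontr)
    let ?p = "s * g + t * f"
    assume nd: "\<not> d dvd ?p"
    have "?p mod d = ?p - (?p div d) * d" by (simp add: minus_div_mult_eq_mod)
    also have "\<dots> = (s - (?p div d) * a) * g + (t - (?p div d) * b) * f"
      unfolding ab by (simp add: algebra_simps)
    finally have "?p mod d \<in> ?I" using nd by (auto simp: dvd_eq_mod_eq_0)
    then have "degree d \<le> degree (?p mod d)" by (rule min)
    moreover have "degree (?p mod d) < degree d"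
      using degree_mod_less[of d ?p] d nd by (auto simp: dvd_eq_mod_eq_0)
    ultimately show False by simp
  qed
  have "d dvd f" "d dvd g" using dvd[of 0 1] dvd[of 1 0] by simp_all
  then obtain e where e: "f = d * e" by (auto simp: dvd_def)
  have "\<not> is_unit e"
  proof
    assume "is_unit e"
    then have "f dvd d" using e by (simp add: mult_unit_dvd_iff)
    then show False using g \<open>d dvd g\<close> dvd_trans by blast
  qed
  then have "is_unit d" using irreducibleD[OF f e] by blast
  then obtain u where "1 = d * u" by (auto simp: dvd_def)
  then have "u * a * g + u * b * f = 1" using ab by (simp add: algebra_simps)
  then show ?thesis by blast
qed

lemma irreducible_bezout_power:
  fixes f g :: "'f::field poly"
  assumes f: "irreducible f" and g: "\<not> f dvd g"
  shows "\<exists>a b. a * g + b * f ^ n = 1"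
proof (induction n)
  case 0
  have "0 * g + 1 * f ^ 0 = 1" by simp
  then show ?case by blast
next
  case (Suc n)
  then obtain a b where 1: "a * g + b * f ^ n = 1" by blast
  obtain c d where 2: "c * g + d * f = 1" using irreducible_bezout[OF f g] by blast
  have "(a * g + b * f ^ n) * (c * g + d * f) = 1" using 1 2 by simp
  then have "(a * (c * g + d * f) + b * f ^ n * c) * g + (b * d) * f ^ Suc n = 1"
    by (simp add: algebra_simps)
  then show ?case by blast
qed

lemma monic_dvd_eq_degree:
  fixes p r :: "'f::field poly"
  assumes "monic p" "monic r" "p dvd r" "degree p = degree r"
  shows "p = r"
proof -
  obtain s where s: "r = p * s" using assms(3) by (auto simp: dvd_def)
  have nz: "p \<noteq> 0" "r \<noteq> 0" using assms by auto
  then have "s \<noteq> 0" using s by auto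
  then have "degree s = 0" using assms(4) s nz by (simp add: degree_mult_eq)
  then obtain c where c: "s = [:c:]" by (rule degree_eq_zeroE)
  have "lead_coeff r = lead_coeff p * c" unfolding s c by (simp add: lead_coeff_mult)
  then show ?thesis using assms s c by simp
qed

lemma irreducible_dvd_mult:
  fixes f :: "'f::field poly"
  assumes f: "irreducible f" and d: "f dvd x * y" "\<not> f dvd x"
  shows "f dvd y"
  using field_poly_irreducible_imp_prime[OF f] d by (auto simp: prime_elem_def)

text \<open>Fermat's little theorem in \<open>F[t]/f\<close>: if \<open>t\<close> is not divisible by \<open>f\<close>, multiplication by \<open>t\<close>
  permutes the nonzero residues, so comparing their product before and after gives
  \<open>t ^ (q ^ degree f - 1) = 1\<close> modulo \<open>f\<close>.\<close>
lemma irreducible_dvd_frobenius: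
  fixes f :: "'f::{field,finite} poly"
  assumes f: "irreducible f" "degree f > 0"
  shows "f dvd [:0, 1:] ^ (CARD('f) ^ degree f) - [:0, 1:]"
proof (cases "f dvd [:0, 1:]")
  case True
  moreover have "[:0, 1 :: 'f:] dvd [:0, 1:] ^ (CARD('f) ^ degree f)" by (rule dvd_power) simp
  ultimately show ?thesis by (meson dvd_diff dvd_trans)
next
  case X: False
  let ?X = "[:0, 1 :: 'f:]" and ?D = "{r :: 'f poly. degree r < degree f} - {0}"
  let ?g = "\<lambda>r. (?X * r) mod f"
  note card = card_poly_degree_less[OF f(2), where 'f = 'f]
  have "CARD('f) ^ degree f > 0" by simp
  then have "finite {r :: 'f poly. degree r < degree f}" unfolding card[symmetric] by (rule card_ge_0_finite)
  then have finD: "finite ?D" by simp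
  have cD: "card ?D = CARD('f) ^ degree f - 1"
    using card f(2) finD by (subst card_Diff_singleton) auto
  have nd: "\<not> f dvd r" if "r \<in> ?D" for r
    using that dvd_imp_degree_le[of f r] by auto
  have inj: "inj_on ?g ?D"
  proof (rule inj_onI)
    fix r s assume rs: "r \<in> ?D" "s \<in> ?D" and e: "?g r = ?g s"
    have "f dvd ?X * (r - s)" using e by (simp add: mod_eq_dvd_iff right_diff_distrib)
    then have "f dvd r - s" using irreducible_dvd_mult[OF f(1) _ X] by blast
    moreover have "degree (r - s) < degree f" using rs by (intro degree_diff_less) auto
    ultimately show "r = s" using dvd_imp_degree_le[of f "r - s"] by fastforce
  qed
  have sub: "?g ` ?D \<subseteq> ?D"
  proof
    fix t assume "t \<in> ?g ` ?D"
    then obtain r where r: "r \<in> ?D" "t = ?g r" by blast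
    have "t \<noteq> 0"
    proof
      assume "t = 0"
      then have "f dvd ?X * r" by (simp only: r(2) dvd_eq_mod_eq_0)
      then show False using irreducible_dvd_mult[OF f(1) _ X] nd[OF r(1)] by blast
    qed
    moreover have "degree t < degree f"
      using degree_mod_less'[of f "?X * r"] f(2) \<open>t \<noteq> 0\<close> r(2) by (metis degree_0 less_irrefl)
    ultimately show "t \<in> ?D" by simp
  qed
  then have "?g ` ?D = ?D" using finD inj by (simp add: card_subset_eq card_image)
  then have "(\<Prod>r\<in>?D. ?g r) = \<Prod>?D"
    using prod.reindex[OF inj, of "\<lambda>x. x"] by simp
  then have "\<Prod>?D mod f = (\<Prod>r\<in>?D. ?X * r) mod f"
    by (metis mod_prod_eq)
  also have "(\<Prod>r\<in>?D. ?X * r) = ?X ^ card ?D * \<Prod>?D"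
    by (simp only: prod.distrib prod_constant)
  finally have "f dvd (?X ^ card ?D - 1) * \<Prod>?D"
    by (simp add: mod_eq_dvd_iff left_diff_distrib dvd_diff_commute)
  moreover have "\<not> f dvd \<Prod>?D"
  proof -
    have "\<not> f dvd \<Prod>E" if "E \<subseteq> ?D" for E
      using finite_subset[OF that finD] that
    proof (induction E)
      case empty
      then show ?case using f by auto
    next
      case (insert r E)
      then show ?case using nd[of r] irreducible_dvd_mult[OF f(1), of r "\<Prod>E"] by auto
    qed
    then show ?thesis by blast
  qed
  ultimately have "f dvd ?X ^ card ?D - 1"
    using irreducible_dvd_mult[OF f(1), of "\<Prod>?D" "?X ^ card ?D - 1"] by (simp add: mult.commute)
  then have "f dvd ?X * (?X ^ card ?D - 1)" by (rule dvd_mult)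
  also have "?X * (?X ^ card ?D - 1) = ?X ^ Suc (card ?D) - ?X" by (simp add: algebra_simps)
  also have "Suc (card ?D) = CARD('f) ^ degree f" using cD by simp
  finally show ?thesis .
qed

text \<open>Fermat's little theorem for \<open>t - a\<close>, evaluated at its root \<open>a\<close>.\<close>
lemma frobenius_fixed: "a ^ CARD('k) = (a :: 'k::{field,finite})"
proof -
  have "[:- a, 1:] dvd [:0, 1:] ^ CARD('k) - [:0, 1:]"
    using irreducible_dvd_frobenius[of "[:- a, 1:]"] by (simp add: irreducible_linear_field_poly)
  then have "poly ([:0, 1:] ^ CARD('k) - [:0, 1:]) a = 0"
    by (simp only: poly_eq_0_iff_dvd)
  then show ?thesis by simp
qed

lemma prod_roots_dvd:
  fixes g :: "'k::field poly"
  assumes "finite S" "\<And>a. a \<in> S \<Longrightarrow> poly g a = 0"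
  shows "(\<Prod>a\<in>S. [:- a, 1:]) dvd g"
  using assms
proof (induction S)
  case (insert a S)
  then obtain u where u: "g = (\<Prod>a\<in>S. [:- a, 1:]) * u" by (auto simp: dvd_def)
  have "poly (\<Prod>a\<in>S. [:- a, 1:]) a \<noteq> 0" using insert.hyps by (auto simp: poly_prod)
  then have "poly u a = 0" using insert.prems[of a] u by simp
  then have "[:- a, 1:] dvd u" by (simp add: poly_eq_0_iff_dvd)
  then have "[:- a, 1:] * (\<Prod>a\<in>S. [:- a, 1:]) dvd g"
    unfolding u by (metis mult.commute mult_dvd_mono dvd_refl)
  then show ?case using insert.hyps by simp
qed simp

text \<open>Every element of \<open>K\<close> is a root of \<open>t ^ Q - t\<close>, which has degree \<open>Q\<close>; so no factor of it can
  have fewer roots than its degree.\<close>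
lemma split_of_dvd_frobenius:
  fixes g :: "'k::{field,finite} poly"
  assumes g: "monic g" and d: "g dvd [:0, 1:] ^ CARD('k) - [:0, 1:]"
  shows "card {a. poly g a = 0} = degree g" "g = (\<Prod>a | poly g a = 0. [:- a, 1:])"
proof -
  let ?Q = "CARD('k)" and ?S = "{a. poly g a = 0}"
  have Q: "?Q \<ge> 2" using card_field_gt_1[where 'k = 'k] by simp
  have deg: "degree ([:0, 1 :: 'k:] ^ ?Q - [:0, 1:]) = ?Q"
    using Q by (subst diff_conv_add_uminus, subst degree_add_eq_left) (auto simp: degree_power_eq)
  obtain u where u: "[:0, 1:] ^ ?Q - [:0, 1:] = g * u" using d by (auto simp: dvd_def)
  have nz: "g \<noteq> 0" "u \<noteq> 0" using deg Q u by auto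
  have "poly (g * u) a = 0" for a
    unfolding u[symmetric] by (simp add: frobenius_fixed)
  then have "UNIV = ?S \<union> {a. poly u a = 0}" by auto
  then have "?Q \<le> card ?S + card {a. poly u a = 0}" by (metis card_Un_le)
  moreover have "card {a. poly u a = 0} \<le> degree u" using nz by (intro card_poly_roots_bound)
  moreover have "degree g + degree u = ?Q" using deg u nz by (simp add: degree_mult_eq)
  moreover have "card ?S \<le> degree g" using nz by (intro card_poly_roots_bound)
  ultimately show c: "card ?S = degree g" by simp
  have "monic (\<Prod>a\<in>?S. [:- a, 1:])" by (rule monic_prod) simp
  moreover have "degree (\<Prod>a\<in>?S. [:- a, 1:]) = card ?S"
    by (subst degree_prod_eq_sum_degree) auto
  moreover have "(\<Prod>a\<in>?S. [:- a, 1:]) dvd g" by (rule prod_roots_dvd) auto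
  moreover have "degree (\<Prod>a\<in>?S. [:- a, 1:]) = degree g" using calculation(2) c by simp
  ultimately show "g = (\<Prod>a\<in>?S. [:- a, 1:])"
    using monic_dvd_eq_degree[of "\<Prod>a\<in>?S. [:- a, 1:]" g] g by simp
qed

lemma field_hom_power_dvd:
  fixes h :: "'f::{field,finite} \<Rightarrow> 'k::{field,finite}" and f :: "'f poly"
  assumes h: "field_hom h" and f: "f dvd [:0, 1:] ^ N - [:0, 1:]"
  shows "map_poly h f dvd [:0, 1:] ^ N - [:0, 1:]"
proof -
  interpret h: field_hom h by (rule h)
  interpret hp: map_poly_inj_idom_hom h ..
  have "map_poly h f dvd map_poly h ([:0, 1:] ^ N - [:0, 1:])" using f by (rule hp.hom_dvd)
  then show ?thesis by (simp add: hom_distribs)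
qed

text \<open>Distinct monic irreducible polynomials satisfy a Bezout identity, which survives in the extension
  and excludes a common root there.\<close>
lemma irreducible_common_root:
  fixes h :: "'f::field \<Rightarrow> 'k::field" and f g :: "'f poly"
  assumes h: "field_hom h" and f: "irreducible f" "monic f" and g: "monic g" "degree g = degree f"
    and a: "poly (map_poly h f) a = 0" "poly (map_poly h g) a = 0"
  shows "f = g"
proof (cases "f dvd g")
  case True
  then show ?thesis using f g by (intro monic_dvd_eq_degree) auto
next
  case False
  interpret h: field_hom h by (rule h)
  interpret hp: map_poly_inj_idom_hom h ..
  obtain s t where "s * g + t * f = 1" using irreducible_bezout[OF f(1) False] by blast
  then have "map_poly h (s * g + t * f) = 1" by simp
  then have "map_poly h s * map_poly h g + map_poly h t * map_poly h f = 1" by (simp add: hom_distribs)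
  from arg_cong[OF this, of "\<lambda>p. poly p a"] have False using a by simp
  then show ?thesis ..
qed

section \<open>Vector spaces with an endomorphism as modules over polynomials\<close>

text \<open>The endomorphism \<open>Y\<close> makes \<open>V\<close> a module over polynomials, a polynomial \<open>p\<close> acting by
  \<open>poly_endo V p Y\<close>.\<close>
locale lin_endo = vectorspace "class_ring :: 'f::field ring" V
  for V :: "('f::field, 'v) module" +
  fixes Y :: "'v \<Rightarrow> 'v"
  assumes Y_hom: "Y \<in> module_hom class_ring V V"
begin

abbreviation act :: "'f poly \<Rightarrow> 'v \<Rightarrow> 'v" where "act p v \<equiv> poly_endo V p Y v"

lemma smult_UNIV_closed [simp, intro]: "v \<in> carrier V \<Longrightarrow> a \<odot>\<^bsub>V\<^esub> v \<in> carrier V"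
  using smult_closed by simp

lemma smult_distr:
  "v \<in> carrier V \<Longrightarrow> (a + b) \<odot>\<^bsub>V\<^esub> v = a \<odot>\<^bsub>V\<^esub> v \<oplus>\<^bsub>V\<^esub> b \<odot>\<^bsub>V\<^esub> v"
  "v \<in> carrier V \<Longrightarrow> w \<in> carrier V \<Longrightarrow> a \<odot>\<^bsub>V\<^esub> (v \<oplus>\<^bsub>V\<^esub> w) = a \<odot>\<^bsub>V\<^esub> v \<oplus>\<^bsub>V\<^esub> a \<odot>\<^bsub>V\<^esub> w"
  "v \<in> carrier V \<Longrightarrow> (a * b) \<odot>\<^bsub>V\<^esub> v = a \<odot>\<^bsub>V\<^esub> (b \<odot>\<^bsub>V\<^esub> v)"
  "v \<in> carrier V \<Longrightarrow> 1 \<odot>\<^bsub>V\<^esub> v = v"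
  "v \<in> carrier V \<Longrightarrow> 0 \<odot>\<^bsub>V\<^esub> v = \<zero>\<^bsub>V\<^esub>"
  "a \<odot>\<^bsub>V\<^esub> \<zero>\<^bsub>V\<^esub> = \<zero>\<^bsub>V\<^esub>"
  using smult_l_distr[of a b v] smult_r_distr[of a v w] smult_assoc1[of a b v] smult_one[of v]
    smult_l_null[of v] smult_r_null[of a]
  by simp_all

lemma Y_closed [simp, intro]: "v \<in> carrier V \<Longrightarrow> Y v \<in> carrier V"
  and Y_add: "v \<in> carrier V \<Longrightarrow> w \<in> carrier V \<Longrightarrow> Y (v \<oplus>\<^bsub>V\<^esub> w) = Y v \<oplus>\<^bsub>V\<^esub> Y w"
  and Y_smult: "v \<in> carrier V \<Longrightarrow> Y (a \<odot>\<^bsub>V\<^esub> v) = a \<odot>\<^bsub>V\<^esub> Y v"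
  using Y_hom by (auto simp: module_hom_def)

lemma Y_zero [simp]: "Y \<zero>\<^bsub>V\<^esub> = \<zero>\<^bsub>V\<^esub>"
  using Y_smult[of "\<zero>\<^bsub>V\<^esub>" 0] by (simp add: smult_distr)

lemma funpow_closed [simp, intro]: "v \<in> carrier V \<Longrightarrow> (Y ^^ n) v \<in> carrier V"
  by (induction n) auto

lemma act_upper_bound:
  assumes v: "v \<in> carrier V" and n: "n \<ge> degree p"
  shows "act p v = finsum V (\<lambda>i. coeff p i \<odot>\<^bsub>V\<^esub> (Y ^^ i) v) {..n}"
  using n
proof (induction n rule: nat_induct_at_least)
  case base
  show ?case by (simp add: poly_endo_def)
next
  case (Suc n)
  then have "coeff p (Suc n) = 0" by (intro coeff_eq_0) simp
  then show ?case using Suc v by (simp add: smult_distr)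
qed

text \<open>Horner's scheme; all further properties of the action follow from it by induction on the
  polynomial.\<close>
lemma act_pCons:
  assumes v: "v \<in> carrier V"
  shows "act (pCons a p) v = a \<odot>\<^bsub>V\<^esub> v \<oplus>\<^bsub>V\<^esub> Y (act p v)"
proof -
  have "finsum V (\<lambda>i. coeff (pCons a p) i \<odot>\<^bsub>V\<^esub> (Y ^^ i) v) {..Suc n}
      = a \<odot>\<^bsub>V\<^esub> v \<oplus>\<^bsub>V\<^esub> Y (finsum V (\<lambda>i. coeff p i \<odot>\<^bsub>V\<^esub> (Y ^^ i) v) {..n})" for n
  proof (induction n)
    case 0
    show ?case using v by (simp add: Y_smult a_comm)
  next
    case (Suc n)
    let ?S = "finsum V (\<lambda>i. coeff p i \<odot>\<^bsub>V\<^esub> (Y ^^ i) v) {..n}"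
    let ?t = "coeff p (Suc n) \<odot>\<^bsub>V\<^esub> (Y ^^ Suc n) v"
    have S: "?S \<in> carrier V" using v by (intro finsum_closed) auto
    have "finsum V (\<lambda>i. coeff (pCons a p) i \<odot>\<^bsub>V\<^esub> (Y ^^ i) v) {..Suc (Suc n)}
        = Y ?t \<oplus>\<^bsub>V\<^esub> (a \<odot>\<^bsub>V\<^esub> v \<oplus>\<^bsub>V\<^esub> Y ?S)"
      using v Suc by (subst finsum_Suc) (auto simp: Y_smult)
    also have "\<dots> = a \<odot>\<^bsub>V\<^esub> v \<oplus>\<^bsub>V\<^esub> Y (?t \<oplus>\<^bsub>V\<^esub> ?S)"
      using v S by (subst Y_add) (auto simp: a_lcomm simp del: funpow.simps)
    also have "?t \<oplus>\<^bsub>V\<^esub> ?S = finsum V (\<lambda>i. coeff p i \<odot>\<^bsub>V\<^esub> (Y ^^ i) v) {..Suc n}"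
      using v by (subst finsum_Suc) auto
    finally show ?case .
  qed
  then show ?thesis
    using act_upper_bound[OF v, of "pCons a p" "Suc (degree p)"] act_upper_bound[OF v order_refl, of p]
    by (simp add: degree_pCons_le)
qed

lemma act_0 [simp]: "v \<in> carrier V \<Longrightarrow> act 0 v = \<zero>\<^bsub>V\<^esub>"
  by (simp add: poly_endo_def smult_distr)

lemma act_closed [simp, intro]: "v \<in> carrier V \<Longrightarrow> act p v \<in> carrier V"
  by (induction p) (auto simp: act_pCons)

lemma act_add:
  assumes v: "v \<in> carrier V"
  shows "act (p + r) v = act p v \<oplus>\<^bsub>V\<^esub> act r v"
  using v by (induction p r rule: poly_induct2) (simp_all add: act_pCons smult_distr Y_add a_ac)

lemma act_smult:
  assumes v: "v \<in> carrier V"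
  shows "act (Polynomial.smult c p) v = c \<odot>\<^bsub>V\<^esub> act p v"
  using v by (induction p) (simp_all add: act_pCons smult_distr Y_smult)

lemma act_linear:
  assumes v: "v \<in> carrier V" and w: "w \<in> carrier V"
  shows "act p (v \<oplus>\<^bsub>V\<^esub> w) = act p v \<oplus>\<^bsub>V\<^esub> act p w" "act p (c \<odot>\<^bsub>V\<^esub> v) = c \<odot>\<^bsub>V\<^esub> act p v"
proof -
  show "act p (v \<oplus>\<^bsub>V\<^esub> w) = act p v \<oplus>\<^bsub>V\<^esub> act p w"
    using v w by (induction p) (simp_all add: act_pCons smult_distr Y_add a_ac)
  show "act p (c \<odot>\<^bsub>V\<^esub> v) = c \<odot>\<^bsub>V\<^esub> act p v"
    using v by (induction p) (simp_all add: act_pCons smult_distr Y_smult mult.commute flip: smult_distr(3))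
qed

lemma act_zero [simp]: "act p \<zero>\<^bsub>V\<^esub> = \<zero>\<^bsub>V\<^esub>"
  using act_linear(2)[of "\<zero>\<^bsub>V\<^esub>" "\<zero>\<^bsub>V\<^esub>" p 0] by (simp add: smult_distr)

lemma act_mult:
  assumes v: "v \<in> carrier V"
  shows "act (p * r) v = act p (act r v)"
  using v by (induction p) (simp_all add: act_pCons act_add act_smult smult_distr)

lemma act_comm: "v \<in> carrier V \<Longrightarrow> act p (act r v) = act r (act p v)"
  by (simp add: act_mult[symmetric] mult.commute)

lemma act_1 [simp]: "v \<in> carrier V \<Longrightarrow> act 1 v = v"
  by (simp add: one_pCons act_pCons smult_distr)

lemma act_power: "v \<in> carrier V \<Longrightarrow> (act p ^^ n) v = act (p ^ n) v"
  by (induction n) (simp_all add: act_mult)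

lemma act_sum:
  assumes v: "v \<in> carrier V" and "finite S"
  shows "act (sum g S) v = finsum V (\<lambda>i. act (g i) v) S"
  using assms(2) by (induction S) (simp_all add: act_add v Pi_def)

lemma act_finsum:
  assumes "finite S" "w \<in> S \<rightarrow> carrier V"
  shows "act p (finsum V w S) = finsum V (\<lambda>i. act p (w i)) S"
  using assms by (induction S) (auto simp: act_linear Pi_def)

lemma finsum_swap:
  assumes "finite S" "finite T" "\<And>i j. i \<in> S \<Longrightarrow> j \<in> T \<Longrightarrow> g i j \<in> carrier V"
  shows "finsum V (\<lambda>i. finsum V (g i) T) S = finsum V (\<lambda>j. finsum V (\<lambda>i. g i j) S) T"
  using assms(1,3)
proof (induction S)
  case empty
  then show ?case by (simp add: finsum_zero)
next
  case (insert x S)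
  have "finsum V (\<lambda>j. finsum V (\<lambda>i. g i j) (insert x S)) T
      = finsum V (\<lambda>j. g x j \<oplus>\<^bsub>V\<^esub> finsum V (\<lambda>i. g i j) S) T"
    using insert by (intro finsum_cong') (auto simp: Pi_def)
  also have "\<dots> = finsum V (g x) T \<oplus>\<^bsub>V\<^esub> finsum V (\<lambda>j. finsum V (\<lambda>i. g i j) S) T"
    using insert by (intro finsum_addf) auto
  finally show ?case using insert by (simp add: Pi_def)
qed

lemma act_minus: "v \<in> carrier V \<Longrightarrow> act (- p) v = \<ominus>\<^bsub>V\<^esub> act p v"
  using act_add[of v "- p" p] by (intro M.minus_equality[symmetric]) auto

lemma act_diff: "v \<in> carrier V \<Longrightarrow> act (p - r) v = act p v \<ominus>\<^bsub>V\<^esub> act r v"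
  using act_add[of v p "- r"] by (simp add: act_minus a_minus_def)

lemma act_vector_diff:
  "v \<in> carrier V \<Longrightarrow> w \<in> carrier V \<Longrightarrow> act p (v \<ominus>\<^bsub>V\<^esub> w) = act p v \<ominus>\<^bsub>V\<^esub> act p w"
proof -
  assume v: "v \<in> carrier V" and w: "w \<in> carrier V"
  have "act p v = act p ((v \<ominus>\<^bsub>V\<^esub> w) \<oplus>\<^bsub>V\<^esub> w)"
    using v w by (simp add: a_minus_def a_assoc l_neg)
  also have "\<dots> = act p (v \<ominus>\<^bsub>V\<^esub> w) \<oplus>\<^bsub>V\<^esub> act p w"
    using v w by (simp add: act_linear a_minus_def)
  finally show ?thesis
    using v w by (simp add: a_minus_def a_assoc r_neg)
qed

end

context lin_endo
begin

abbreviation ker :: "'f poly \<Rightarrow> 'v set" where "ker p \<equiv> {v \<in> carrier V. act p v = \<zero>\<^bsub>V\<^esub>}"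

abbreviation ann :: "'f poly \<Rightarrow> bool" where "ann p \<equiv> \<forall>v\<in>carrier V. act p v = \<zero>\<^bsub>V\<^esub>"

lemma ann_mult: "ann p \<Longrightarrow> ann (r * p)"
  by (simp add: act_mult)

lemma ann_diff: "ann p \<Longrightarrow> ann r \<Longrightarrow> ann (p - r)"
  by (simp add: act_diff a_minus_def)

text \<open>A nonzero annihilating polynomial of least degree generates the ideal of all annihilating
  polynomials; scaling makes it monic.\<close>
lemma min_poly_endo_exists:
  assumes p: "p \<noteq> 0" "ann p"
  shows "\<exists>m. monic m \<and> ann m \<and> (\<forall>r. ann r \<longrightarrow> m dvd r)"
proof -
  let ?I = "\<lambda>p. p \<noteq> 0 \<and> ann p"
  obtain d where d: "?I d" and min: "\<And>p. ?I p \<Longrightarrow> degree d \<le> degree p"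
    using ex_has_least_nat[of ?I p degree] p by blast
  have dvd: "d dvd r" if "ann r" for r
  proof (rule ccontr)
    assume nd: "\<not> d dvd r"
    have "r mod d = r - (r div d) * d" by (simp add: minus_div_mult_eq_mod)
    then have "ann (r mod d)" using ann_diff[OF that ann_mult[of d "r div d"]] d by simp
    then have "degree d \<le> degree (r mod d)" using nd by (intro min) (auto simp: dvd_eq_mod_eq_0)
    moreover have "degree (r mod d) < degree d"
      using degree_mod_less[of d r] d nd by (auto simp: dvd_eq_mod_eq_0)
    ultimately show False by simp
  qed
  let ?m = "Polynomial.smult (inverse (lead_coeff d)) d"
  have "monic ?m" using d by simp
  moreover have "ann ?m" using d by (simp add: act_smult smult_distr)
  moreover have "?m dvd r" if "ann r" for r using dvd[OF that] d by (simp add: smult_dvd)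
  ultimately show ?thesis by blast
qed

lemma min_poly_endo:
  assumes p: "p \<noteq> 0" "ann p"
  shows "monic (min_poly_endo V Y)" "ann (min_poly_endo V Y)" "ann r \<Longrightarrow> min_poly_endo V Y dvd r"
proof -
  let ?P = "\<lambda>m. monic m \<and> ann m \<and> (\<forall>r. ann r \<longrightarrow> m dvd r)"
  have "\<exists>!m. ?P m"
  proof (rule ex_ex1I[OF min_poly_endo_exists[OF p]])
    fix m m' assume m: "?P m" and m': "?P m'"
    show "m = m'" using m m' by (intro poly_dvd_antisym) auto
  qed
  then have "?P (min_poly_endo V Y)" unfolding min_poly_endo_def by (rule theI')
  then show "monic (min_poly_endo V Y)" "ann (min_poly_endo V Y)" "ann r \<Longrightarrow> min_poly_endo V Y dvd r"
    by blast+
qed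

lemma ordered_basis_carrier:
  assumes "ordered_basis V bs"
  shows "set bs \<subseteq> carrier V" "i < length bs \<Longrightarrow> bs ! i \<in> carrier V"
  using assms by (auto simp: ordered_basis_def basis_def subset_iff)

lemma lincomb_list:
  assumes bs: "distinct bs" "set bs \<subseteq> carrier V"
  shows "lincomb a (set bs) = finsum V (\<lambda>i. a (bs ! i) \<odot>\<^bsub>V\<^esub> (bs ! i)) {..<length bs}"
proof -
  have "set bs = (!) bs ` {..<length bs}" by (auto simp: set_conv_nth)
  moreover have "inj_on ((!) bs) {..<length bs}" using bs(1) by (auto simp: inj_on_def nth_eq_iff_index_eq)
  moreover have "bs ! i \<in> carrier V" if "i < length bs" for i using bs(2) that by auto
  ultimately show ?thesis unfolding lincomb_def by (simp only:) (subst finsum_reindex, auto)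
qed

lemma represents_exists:
  assumes "ordered_basis V bs"
  shows "\<exists>A. represents V bs A Y"
proof -
  have bs: "distinct bs" "basis (set bs)" and C: "set bs \<subseteq> carrier V"
    using assms ordered_basis_carrier by (auto simp: ordered_basis_def)
  have "\<exists>a. lincomb a (set bs) = Y (bs ! j)" if "j < length bs" for j
  proof -
    have "Y (bs ! j) \<in> carrier V" using ordered_basis_carrier(2)[OF assms that] by (rule Y_closed)
    then have "Y (bs ! j) \<in> span (set bs)" using bs(2) by (simp add: basis_def)
    then show ?thesis using finite_span[of "set bs"] C by auto
  qed
  then obtain a where a: "\<And>j. j < length bs \<Longrightarrow> lincomb (a j) (set bs) = Y (bs ! j)" by metis
  let ?A = "Matrix.mat (length bs) (length bs) (\<lambda>(i, j). a j (bs ! i))"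
  have "represents V bs ?A Y"
    unfolding represents_def
  proof (intro conjI allI impI)
    fix j assume j: "j < length bs"
    have "Y (bs ! j) = finsum V (\<lambda>i. a j (bs ! i) \<odot>\<^bsub>V\<^esub> (bs ! i)) {..<length bs}"
      using a[OF j] lincomb_list[OF bs(1) C] by simp
    also have "\<dots> = finsum V (\<lambda>i. ?A $$ (i, j) \<odot>\<^bsub>V\<^esub> (bs ! i)) {..<length bs}"
      using C j by (intro finsum_cong') (auto simp: subset_iff)
    finally show "Y (bs ! j) = finsum V (\<lambda>i. ?A $$ (i, j) \<odot>\<^bsub>V\<^esub> (bs ! i)) {..<length bs}" .
  qed simp
  then show ?thesis by blast
qed

lemma ker_submodule: "submodule class_ring (ker p) V"
  by (rule submodule.intro) (auto simp: act_linear smult_distr module_axioms)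

text \<open>The determinant trick: in the polynomial module the basis vectors satisfy
  \<open>\<Sum>i. (t I - A) (i, j) b i = 0\<close> for all \<open>j\<close>, and multiplying these relations by the adjugate matrix
  leaves \<open>det (t I - A) b k = 0\<close>.\<close>
lemma cayley_hamilton:
  assumes bs: "ordered_basis V bs" and A: "represents V bs A Y"
  shows "ann (char_poly A)"
proof -
  let ?n = "length bs"
  let ?C = "char_poly_matrix A"
  let ?J = "adj_mat ?C"
  have Acar: "A \<in> carrier_mat ?n ?n" using A by (simp add: represents_def)
  then have Ccar: "?C \<in> carrier_mat ?n ?n" by simp
  have Jcar: "?J \<in> carrier_mat ?n ?n" by (rule adj_mat(1)[OF Ccar])
  have b [simp]: "bs ! i \<in> carrier V" if "i < ?n" for i using ordered_basis_carrier[OF bs] that by blast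
  have C_entry: "?C $$ (i, j) = (if i = j then [:0, 1:] else 0) - [:A $$ (i, j):]" if "i < ?n" "j < ?n" for i j
    using that Acar by (auto simp: char_poly_matrix_def)
  have X: "act [:0, 1:] v = Y v" if "v \<in> carrier V" for v
    using that by (simp add: act_pCons smult_distr)
  have const: "act [:c:] v = c \<odot>\<^bsub>V\<^esub> v" if "v \<in> carrier V" for c v
    using that by (simp add: act_pCons smult_distr)
  have row: "finsum V (\<lambda>i. act (?C $$ (i, j)) (bs ! i)) {..<?n} = \<zero>\<^bsub>V\<^esub>" if j: "j < ?n" for j
  proof -
    let ?s = "finsum V (\<lambda>i. A $$ (i, j) \<odot>\<^bsub>V\<^esub> (bs ! i)) {..<?n}"
    have s: "?s \<in> carrier V" by (intro finsum_closed) auto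
    have "finsum V (\<lambda>i. act (?C $$ (i, j)) (bs ! i)) {..<?n} \<oplus>\<^bsub>V\<^esub> ?s
        = finsum V (\<lambda>i. act (?C $$ (i, j)) (bs ! i) \<oplus>\<^bsub>V\<^esub> A $$ (i, j) \<odot>\<^bsub>V\<^esub> (bs ! i)) {..<?n}"
      by (intro finsum_addf[symmetric]) auto
    also have "\<dots> = finsum V (\<lambda>i. if j = i then Y (bs ! i) else \<zero>\<^bsub>V\<^esub>) {..<?n}"
    proof (intro finsum_cong' refl)
      fix i assume i: "i \<in> {..<?n}"
      then have "act (?C $$ (i, j)) (bs ! i) \<oplus>\<^bsub>V\<^esub> A $$ (i, j) \<odot>\<^bsub>V\<^esub> (bs ! i)
          = act (?C $$ (i, j) + [:A $$ (i, j):]) (bs ! i)"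
        by (simp add: act_add const)
      also have "?C $$ (i, j) + [:A $$ (i, j):] = (if i = j then [:0, 1:] else 0)"
        using C_entry[of i j] i j by simp
      finally show "act (?C $$ (i, j)) (bs ! i) \<oplus>\<^bsub>V\<^esub> A $$ (i, j) \<odot>\<^bsub>V\<^esub> (bs ! i)
          = (if j = i then Y (bs ! i) else \<zero>\<^bsub>V\<^esub>)"
        using i by (simp add: X)
    qed auto
    also have "\<dots> = Y (bs ! j)" using j by (subst finsum_singleton) auto
    also have "\<dots> = ?s" using A j by (simp add: represents_def)
    finally show ?thesis using s by (simp add: M.add.l_cancel_one')
  qed
  have on_basis: "act (char_poly A) (bs ! k) = \<zero>\<^bsub>V\<^esub>" if k: "k < ?n" for k
  proof -
    have entry: "(\<Sum>j<?n. ?C $$ (i, j) * ?J $$ (j, k)) = (if k = i then char_poly A else 0)" if i: "i < ?n" for i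
    proof -
      have "(?C * ?J) $$ (i, k) = (\<Sum>j<?n. ?C $$ (i, j) * ?J $$ (j, k))"
        using i k Ccar Jcar by (auto simp: scalar_prod_def row_def col_def atLeast0LessThan intro!: sum.cong)
      moreover have "(?C * ?J) $$ (i, k) = (if k = i then char_poly A else 0)"
        unfolding adj_mat(2)[OF Ccar] using i k by (simp add: char_poly_def)
      ultimately show ?thesis by simp
    qed
    have "act (char_poly A) (bs ! k) = finsum V (\<lambda>i. if k = i then act (char_poly A) (bs ! i) else \<zero>\<^bsub>V\<^esub>) {..<?n}"
      using k by (subst finsum_singleton) auto
    also have "\<dots> = finsum V (\<lambda>i. act (\<Sum>j<?n. ?C $$ (i, j) * ?J $$ (j, k)) (bs ! i)) {..<?n}"
      by (intro finsum_cong' refl) (auto simp: entry)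
    also have "\<dots> = finsum V (\<lambda>i. finsum V (\<lambda>j. act (?J $$ (j, k)) (act (?C $$ (i, j)) (bs ! i))) {..<?n}) {..<?n}"
    proof (intro finsum_cong' refl)
      fix i assume i: "i \<in> {..<?n}"
      show "act (\<Sum>j<?n. ?C $$ (i, j) * ?J $$ (j, k)) (bs ! i)
          = finsum V (\<lambda>j. act (?J $$ (j, k)) (act (?C $$ (i, j)) (bs ! i))) {..<?n}"
        using i by (simp add: act_sum act_mult[symmetric] mult.commute)
    qed auto
    also have "\<dots> = finsum V (\<lambda>j. finsum V (\<lambda>i. act (?J $$ (j, k)) (act (?C $$ (i, j)) (bs ! i))) {..<?n}) {..<?n}"
      by (rule finsum_swap) auto
    also have "\<dots> = finsum V (\<lambda>j. \<zero>\<^bsub>V\<^esub>) {..<?n}"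
    proof (intro finsum_cong' refl)
      fix j assume j: "j \<in> {..<?n}"
      have "finsum V (\<lambda>i. act (?J $$ (j, k)) (act (?C $$ (i, j)) (bs ! i))) {..<?n}
          = act (?J $$ (j, k)) (finsum V (\<lambda>i. act (?C $$ (i, j)) (bs ! i)) {..<?n})"
        by (rule act_finsum[symmetric]) auto
      then show "finsum V (\<lambda>i. act (?J $$ (j, k)) (act (?C $$ (i, j)) (bs ! i))) {..<?n} = \<zero>\<^bsub>V\<^esub>"
        using row j by simp
    qed auto
    also have "\<dots> = \<zero>\<^bsub>V\<^esub>" by (simp add: M.finsum_zero)
    finally show ?thesis .
  qed
  have "set bs \<subseteq> ker (char_poly A)"
    using on_basis ordered_basis_carrier[OF bs] by (auto simp: in_set_conv_nth)
  then have "span (set bs) \<subseteq> ker (char_poly A)" by (rule span_is_subset[OF _ ker_submodule])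
  then show ?thesis using bs by (auto simp: ordered_basis_def basis_def)
qed

end

locale finite_lin_endo = lin_endo V Y
  for V :: "('f::{field,finite}, 'v) module" and Y +
  assumes fin [simp]: "finite (carrier V)"
begin

lemma ordered_basis_exists: "\<exists>bs. ordered_basis V bs"
proof -
  have "fin_dim" unfolding fin_dim_def
    using fin span_is_subset2[of "carrier V"] in_own_span[of "carrier V"] by blast
  then obtain B where B: "finite B" "basis B" using finite_basis_exists by blast
  then obtain bs where "set bs = B" "distinct bs" using finite_distinct_list by blast
  then show ?thesis using B by (auto simp: ordered_basis_def)
qed

lemma card_carrier_basis:
  assumes "finite B" "basis B"
  shows "card (carrier V) = CARD('f) ^ card B"
proof -
  have C: "B \<subseteq> carrier V" using assms by (simp add: basis_def)
  have ex1: "\<exists>!a. a \<in> B \<rightarrow>\<^sub>E UNIV \<and> lincomb a B = v" if "v \<in> carrier V" for v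
    using basis_criterion[OF assms(1) C] assms(2) that by simp
  have cl: "lincomb a B \<in> carrier V" for a using C by (intro lincomb_closed) auto
  have "bij_betw (\<lambda>a. lincomb a B) (B \<rightarrow>\<^sub>E (UNIV :: 'f set)) (carrier V)"
    unfolding bij_betw_def
  proof
    show "inj_on (\<lambda>a. lincomb a B) (B \<rightarrow>\<^sub>E (UNIV :: 'f set))"
      using ex1[OF cl] by (intro inj_onI) blast
    show "(\<lambda>a. lincomb a B) ` (B \<rightarrow>\<^sub>E (UNIV :: 'f set)) = carrier V"
      using ex1 cl by (auto simp: image_iff) metis
  qed
  from bij_betw_same_card[OF this] show ?thesis using assms(1) by (simp add: card_PiE)
qed

lemma card_carrier_eq_dim: "card (carrier V) = CARD('f) ^ dim"
proof -
  obtain bs where "ordered_basis V bs" using ordered_basis_exists by blast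
  then have "basis (set bs)" by (simp add: ordered_basis_def)
  then show ?thesis using card_carrier_basis[of "set bs"] dim_basis[of "set bs"] by simp
qed

lemma char_poly_endo:
  shows "monic (char_poly_endo V Y)" "ann (char_poly_endo V Y)"
    "card (carrier V) = CARD('f) ^ degree (char_poly_endo V Y)"
proof -
  define A where "A = (SOME A. \<exists>bs. ordered_basis V bs \<and> represents V bs A Y)"
  have "\<exists>bs. ordered_basis V bs \<and> represents V bs A Y"
    unfolding A_def by (rule someI_ex) (use ordered_basis_exists represents_exists in blast)
  then obtain bs where bs: "ordered_basis V bs" and A: "represents V bs A Y" by blast
  have c: "char_poly_endo V Y = char_poly A" by (simp add: char_poly_endo_def A_def)
  have Acar: "A \<in> carrier_mat (length bs) (length bs)" using A by (simp add: represents_def)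
  have deg: "degree (char_poly A) = length bs" "coeff (char_poly A) (length bs) = 1"
    using degree_monic_char_poly[OF Acar] by auto
  show "monic (char_poly_endo V Y)" using deg c by simp
  show "ann (char_poly_endo V Y)" using cayley_hamilton[OF bs A] c by simp
  show "card (carrier V) = CARD('f) ^ degree (char_poly_endo V Y)"
    using card_carrier_basis[of "set bs"] bs deg c
    by (simp add: ordered_basis_def distinct_card)
qed

text \<open>The minimal polynomial divides the characteristic polynomial, so only the degrees have to be
  compared; the degree of the latter is the dimension, which the cardinality determines.\<close>
lemma min_eq_char_iff:
  "min_poly_endo V Y = char_poly_endo V Y \<longleftrightarrow> card (carrier V) = CARD('f) ^ degree (min_poly_endo V Y)"
proof -
  have nz: "char_poly_endo V Y \<noteq> 0" using char_poly_endo(1) by auto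
  note m = min_poly_endo[OF nz char_poly_endo(2)]
  have "min_poly_endo V Y = char_poly_endo V Y \<longleftrightarrow>
      degree (min_poly_endo V Y) = degree (char_poly_endo V Y)"
    using monic_dvd_eq_degree[OF m(1) char_poly_endo(1) m(3)[OF char_poly_endo(2)]] by auto
  also have "\<dots> \<longleftrightarrow> card (carrier V) = CARD('f) ^ degree (min_poly_endo V Y)"
    unfolding char_poly_endo(3) using card_field_gt_1[where 'k = 'f] by (auto simp: power_inject_exp)
  finally show ?thesis .
qed

text \<open>A vector killed by \<open>p * r\<close> is the sum of its images under \<open>b * r\<close> and \<open>a * p\<close>, killed by \<open>p\<close>
  and by \<open>r\<close> respectively.\<close>
lemma card_ker_coprime:
  assumes ab: "a * p + b * r = 1"
  shows "card (ker (p * r)) = card (ker p) * card (ker r)"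
proof -
  have split: "act (a * p) v \<oplus>\<^bsub>V\<^esub> act (b * r) v = v" if "v \<in> carrier V" for v
    using act_add[OF that, of "a * p" "b * r"] ab that by simp
  have kp: "act (a * p) v = \<zero>\<^bsub>V\<^esub>" "act (b * r) v = v" if "v \<in> ker p" for v
    using that split[of v] by (auto simp: act_mult)
  have kr: "act (b * r) v = \<zero>\<^bsub>V\<^esub>" "act (a * p) v = v" if "v \<in> ker r" for v
    using that split[of v] by (auto simp: act_mult)
  have comm: "act p (act (b * r) v) = act b (act (p * r) v)" "act r (act (a * p) v) = act a (act (p * r) v)"
    if "v \<in> carrier V" for v
    using that by (simp_all add: act_mult[symmetric] mult_ac)
  have "bij_betw (\<lambda>(u, w). u \<oplus>\<^bsub>V\<^esub> w) (ker p \<times> ker r) (ker (p * r))"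
  proof (rule bij_betwI[where g = "\<lambda>v. (act (b * r) v, act (a * p) v)"])
    show "(\<lambda>(u, w). u \<oplus>\<^bsub>V\<^esub> w) \<in> ker p \<times> ker r \<rightarrow> ker (p * r)"
    proof (clarsimp simp: act_linear)
      fix u w assume "u \<in> carrier V" "act p u = \<zero>\<^bsub>V\<^esub>" "w \<in> carrier V" "act r w = \<zero>\<^bsub>V\<^esub>"
      then show "act (p * r) u \<oplus>\<^bsub>V\<^esub> act (p * r) w = \<zero>\<^bsub>V\<^esub>"
        using act_mult[of u r p] by (simp add: act_mult[of w] mult.commute)
    qed
    show "(\<lambda>v. (act (b * r) v, act (a * p) v)) \<in> ker (p * r) \<rightarrow> ker p \<times> ker r"
      by (auto simp: comm)
    show "(case (act (b * r) v, act (a * p) v) of (u, w) \<Rightarrow> u \<oplus>\<^bsub>V\<^esub> w) = v" if "v \<in> ker (p * r)" for v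
      using that split[of v] by (simp add: a_comm)
    fix x assume "x \<in> ker p \<times> ker r"
    then obtain u w where x: "x = (u, w)" "u \<in> ker p" "w \<in> ker r" by auto
    then show "(act (b * r) (case x of (u, w) \<Rightarrow> u \<oplus>\<^bsub>V\<^esub> w), act (a * p) (case x of (u, w) \<Rightarrow> u \<oplus>\<^bsub>V\<^esub> w)) = x"
      using kp[OF x(2)] kr[OF x(3)] by (simp add: act_linear)
  qed
  from bij_betw_same_card[OF this] show ?thesis by (simp add: card_cartesian_product)
qed

lemma fin_ker [simp]: "finite (ker p)"
  by (rule finite_subset[OF _ fin]) auto

lemma diff_eq_zero: "u \<in> carrier V \<Longrightarrow> w \<in> carrier V \<Longrightarrow> u \<ominus>\<^bsub>V\<^esub> w = \<zero>\<^bsub>V\<^esub> \<longleftrightarrow> u = w"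
  by (metis M.minus_eq M.minus_equality M.minus_minus M.r_neg M.a_inv_closed)

text \<open>The action of \<open>r\<close> maps the kernel of \<open>p * r\<close> into that of \<open>p\<close>, and each fibre is contained
  in a coset of the kernel of \<open>r\<close>.\<close>
lemma card_ker_mult_le: "card (ker (p * r)) \<le> card (ker p) * card (ker r)"
proof -
  let ?F = "\<lambda>w. {v \<in> carrier V. act r v = w}"
  have le: "card (?F w) \<le> card (ker r)" if "w \<in> ker p" for w
  proof (cases "?F w = {}")
    case False
    then obtain v0 where v0: "v0 \<in> carrier V" "act r v0 = w" by auto
    show ?thesis
    proof (rule card_inj_on_le[of "\<lambda>v. v \<ominus>\<^bsub>V\<^esub> v0"])
      show "inj_on (\<lambda>v. v \<ominus>\<^bsub>V\<^esub> v0) (?F w)"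
        using v0 by (auto simp: inj_on_def a_minus_def)
      show "(\<lambda>v. v \<ominus>\<^bsub>V\<^esub> v0) ` ?F w \<subseteq> ker r"
        using v0 by (auto simp: act_vector_diff diff_eq_zero)
    qed simp
  next
    case True
    then show ?thesis by (simp only: card.empty le0)
  qed
  have "ker (p * r) \<subseteq> (\<Union>w\<in>ker p. ?F w)" by (auto simp: act_mult)
  then have "card (ker (p * r)) \<le> card (\<Union>w\<in>ker p. ?F w)"
    by (intro card_mono) auto
  also have "\<dots> \<le> (\<Sum>w\<in>ker p. card (?F w))" by (intro card_UN_le) simp
  also have "\<dots> \<le> (\<Sum>w\<in>ker p. card (ker r))" using le by (intro sum_mono) auto
  finally show ?thesis by simp
qed

text \<open>The quotient of two successive kernels is a vector space over the field of polynomials modulo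
  \<open>f\<close>.  If it is nonzero it is at least as large as that field: the multiples of \<open>v\<close> by distinct
  polynomials of degree less than that of \<open>f\<close> lie in distinct cosets.\<close>
lemma card_ker_step_ge:
  assumes f: "irreducible f" "degree f > 0"
    and v: "v \<in> ker (f ^ Suc j)" "v \<notin> ker (f ^ j)"
  shows "CARD('f) ^ degree f * card (ker (f ^ j)) \<le> card (ker (f ^ Suc j))"
proof -
  let ?g = "\<lambda>(r, w). act r v \<oplus>\<^bsub>V\<^esub> w"
  let ?D = "{r :: 'f poly. degree r < degree f}"
  have vC: "v \<in> carrier V" using v by simp
  have "inj_on ?g (?D \<times> ker (f ^ j))"
  proof (rule inj_onI, clarify)
    fix r w r' w'
    assume d: "degree r < degree f" "degree r' < degree f"
      and w: "w \<in> carrier V" "act (f ^ j) w = \<zero>\<^bsub>V\<^esub>" and w': "w' \<in> carrier V" "act (f ^ j) w' = \<zero>\<^bsub>V\<^esub>"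
      and eq: "act r v \<oplus>\<^bsub>V\<^esub> w = act r' v \<oplus>\<^bsub>V\<^esub> w'"
    have "act (f ^ j) (act r v \<oplus>\<^bsub>V\<^esub> w) = act (f ^ j) (act r' v \<oplus>\<^bsub>V\<^esub> w')" using eq by simp
    then have "act (f ^ j) (act r v) = act (f ^ j) (act r' v)" using w w' vC by (simp add: act_linear)
    then have k: "act (f ^ j) (act (r - r') v) = \<zero>\<^bsub>V\<^esub>"
      using vC by (simp add: act_diff act_vector_diff diff_eq_zero)
    have "r = r'"
    proof (rule ccontr)
      assume ne: "r \<noteq> r'"
      have "degree (r - r') < degree f" using d by (simp add: degree_diff_less)
      then have "\<not> f dvd r - r'" using ne dvd_imp_degree_le[of f "r - r'"] by auto
      then obtain a b where "a * (r - r') + b * f ^ Suc j = 1"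
        using irreducible_bezout_power[OF f(1)] by blast
      then have "v = act (a * (r - r')) v \<oplus>\<^bsub>V\<^esub> act (b * f ^ Suc j) v"
        using act_add[OF vC, of "a * (r - r')" "b * f ^ Suc j"] vC by simp
      also have "act (b * f ^ Suc j) v = \<zero>\<^bsub>V\<^esub>" using v act_mult[OF vC, of b "f ^ Suc j"] by simp
      finally have "v = act a (act (r - r') v)" using vC by (simp add: act_mult)
      then have "act (f ^ j) v = act a (act (f ^ j) (act (r - r') v))"
        using vC by (metis act_closed act_comm)
      then show False using k v vC by simp
    qed
    then show "r = r' \<and> w = w'" using eq w w' vC by simp
  qed
  moreover have "?g ` (?D \<times> ker (f ^ j)) \<subseteq> ker (f ^ Suc j)"
  proof (clarify, intro conjI)
    fix r w assume w: "w \<in> carrier V" "act (f ^ j) w = \<zero>\<^bsub>V\<^esub>"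
    show "act r v \<oplus>\<^bsub>V\<^esub> w \<in> carrier V" using vC w by simp
    have "act (f ^ Suc j) (act r v) = act r (act (f ^ Suc j) v)" using vC by (rule act_comm)
    then have 1: "act (f ^ Suc j) (act r v) = \<zero>\<^bsub>V\<^esub>" using v by simp
    have 2: "act (f ^ Suc j) w = \<zero>\<^bsub>V\<^esub>" using w act_mult[OF w(1), of f "f ^ j"] by simp
    show "act (f ^ Suc j) (act r v \<oplus>\<^bsub>V\<^esub> w) = \<zero>\<^bsub>V\<^esub>"
      using vC w 1 2 by (subst act_linear(1)) auto
  qed
  ultimately have "card (?D \<times> ker (f ^ j)) \<le> card (ker (f ^ Suc j))"
    by (intro card_inj_on_le) auto
  then show ?thesis using card_poly_degree_less[OF f(2), where 'f = 'f] by (simp add: card_cartesian_product)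
qed

text \<open>Let \<open>k\<close> be least such that \<open>f ^ k\<close> acts as zero; the minimal polynomial has the degree of
  \<open>f ^ k\<close>.  With \<open>b = degree f\<close>, passing from the kernel of \<open>f ^ j\<close> to that of \<open>f ^ (j + 1)\<close>
  multiplies the size by at least \<open>q ^ b\<close> and by at most the size of the kernel of \<open>f\<close>.
  So after \<open>k\<close> steps the size is \<open>q ^ (b * k)\<close>, which means cyclicity, iff the kernel of \<open>f\<close>
  has exactly \<open>q ^ b\<close> elements.\<close>
lemma cyclic_iff_card_ker:
  assumes f: "irreducible f" "degree f > 0" and N: "ann (f ^ N)"
  shows "carrier V \<noteq> {\<zero>\<^bsub>V\<^esub>} \<and> min_poly_endo V Y = char_poly_endo V Y
    \<longleftrightarrow> card (ker f) = CARD('f) ^ degree f"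
proof -
  let ?q = "CARD('f)" and ?b = "degree f" and ?m = "min_poly_endo V Y"
  define k where "k = (LEAST k. ann (f ^ k))"
  have annk: "ann (f ^ k)" unfolding k_def by (rule LeastI[of _ N]) (rule N)
  have least: "\<not> ann (f ^ j)" if "j < k" for j
    using not_less_Least[of j "\<lambda>k. ann (f ^ k)"] that unfolding k_def by blast
  have f0: "f \<noteq> 0" using f(2) by auto
  have "char_poly_endo V Y \<noteq> 0" using char_poly_endo(1) by auto
  note m = min_poly_endo[OF this char_poly_endo(2)]
  have m0: "?m \<noteq> 0" using m(1) by auto

  have deg: "degree ?m = ?b * k"
  proof (rule antisym)
    have "degree ?m \<le> degree (f ^ k)" using m(3)[OF annk] f0 by (intro dvd_imp_degree_le) auto
    then show "degree ?m \<le> ?b * k" by (simp add: degree_power_eq f0 mult.commute)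
    \<comment> \<open>Split off the exact power of \<open>f\<close> from the minimal polynomial; the cofactor acts invertibly.\<close>
    have "finite {j. f ^ j dvd ?m}"
    proof (rule finite_subset)
      show "{j. f ^ j dvd ?m} \<subseteq> {..degree ?m}"
      proof
        fix j assume "j \<in> {j. f ^ j dvd ?m}"
        then have "degree (f ^ j) \<le> degree ?m" using m0 by (intro dvd_imp_degree_le) auto
        then have "?b * j \<le> degree ?m" by (simp add: degree_power_eq f0 mult.commute)
        moreover have "j \<le> ?b * j" using f(2) by simp
        ultimately have "j \<le> degree ?m" by (rule le_trans[rotated])
        then show "j \<in> {..degree ?m}" by simp
      qed
    qed simp
    moreover have "0 \<in> {j. f ^ j dvd ?m}" by simp
    ultimately have mx: "f ^ Max {j. f ^ j dvd ?m} dvd ?m" "\<And>j. f ^ j dvd ?m \<Longrightarrow> j \<le> Max {j. f ^ j dvd ?m}"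
      using Max_in[of "{j. f ^ j dvd ?m}"] by (blast, simp)
    then obtain j g where j: "?m = f ^ j * g" "\<And>i. f ^ i dvd ?m \<Longrightarrow> i \<le> j"
      by (metis dvd_def)
    have "\<not> f dvd g"
    proof
      assume "f dvd g"
      then have "f ^ j * f dvd ?m" unfolding j(1) by (rule mult_dvd_mono[OF dvd_refl])
      then show False using j(2)[of "Suc j"] by (simp add: mult.commute)
    qed
    then obtain a c where ac: "a * g + c * f ^ k = 1" using irreducible_bezout_power[OF f(1)] by blast
    have "ann (f ^ j)"
    proof
      fix v assume v: "v \<in> carrier V"
      have "f ^ j = a * ?m + (f ^ j * c) * f ^ k"
      proof -
        have "f ^ j = f ^ j * (a * g + c * f ^ k)" using ac by simp
        then show ?thesis unfolding j(1) by (simp add: algebra_simps)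
      qed
      then have "act (f ^ j) v = act (a * ?m) v \<oplus>\<^bsub>V\<^esub> act ((f ^ j * c) * f ^ k) v"
        using act_add[OF v] by metis
      also have "\<dots> = \<zero>\<^bsub>V\<^esub>" using ann_mult[OF m(2)] ann_mult[OF annk] v by simp
      finally show "act (f ^ j) v = \<zero>\<^bsub>V\<^esub>" .
    qed
    then have "k \<le> j" using least not_less by blast
    have "degree (f ^ j) \<le> degree ?m" using j(1) m0 by (intro dvd_imp_degree_le) auto
    then have "?b * j \<le> degree ?m" by (simp add: degree_power_eq f0 mult.commute)
    then show "?b * k \<le> degree ?m" using \<open>k \<le> j\<close> by (meson le_trans mult_le_mono2)
  qed

  let ?N = "\<lambda>j. card (ker (f ^ j))"
  have N0: "?N 0 = 1"
  proof -
    have "ker (f ^ 0) = {\<zero>\<^bsub>V\<^esub>}" by auto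
    then show ?thesis by simp
  qed
  have Nk: "?N k = card (carrier V)"
  proof -
    have "ker (f ^ k) = carrier V" using annk by auto
    then show ?thesis by simp
  qed
  have up: "?N (Suc j) \<le> ?N 1 * ?N j" for j
    using card_ker_mult_le[of f "f ^ j"] by simp
  have low: "?q ^ ?b * ?N j \<le> ?N (Suc j)" if j: "j < k" for j
  proof -
    have "\<exists>v. v \<in> ker (f ^ Suc j) \<and> v \<notin> ker (f ^ j)"
    proof (rule ccontr)
      assume neg: "\<not> ?thesis"
      have "ann (f ^ (k - 1))"
      proof
        fix v assume v: "v \<in> carrier V"
        let ?w = "act (f ^ (k - Suc j)) v"
        have e: "f ^ Suc j * f ^ (k - Suc j) = f ^ k" "f ^ j * f ^ (k - Suc j) = f ^ (k - 1)"
          using j power_add[of f "Suc j" "k - Suc j"] power_add[of f j "k - Suc j"] by simp_all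
        have "act (f ^ Suc j) ?w = act (f ^ k) v" by (simp only: act_mult[OF v, symmetric] e)
        then have "?w \<in> ker (f ^ Suc j)" using annk v by simp
        then have "act (f ^ j) ?w = \<zero>\<^bsub>V\<^esub>" using neg by blast
        then show "act (f ^ (k - 1)) v = \<zero>\<^bsub>V\<^esub>" by (simp only: act_mult[OF v, symmetric] e)
      qed
      then show False using least[of "k - 1"] j by simp
    qed
    then show ?thesis using card_ker_step_ge[OF f] by blast
  qed
  have V0: "carrier V \<noteq> {\<zero>\<^bsub>V\<^esub>} \<longleftrightarrow> k > 0"
  proof
    assume "carrier V \<noteq> {\<zero>\<^bsub>V\<^esub>}"
    then have "\<exists>v\<in>carrier V. v \<noteq> \<zero>\<^bsub>V\<^esub>" using M.zero_closed by blast
    then show "k > 0" using annk by (cases k) auto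
  next
    assume "k > 0"
    then have "\<exists>v\<in>carrier V. v \<noteq> \<zero>\<^bsub>V\<^esub>" using least[of 0] by auto
    then show "carrier V \<noteq> {\<zero>\<^bsub>V\<^esub>}" by auto
  qed
  have q0: "?q ^ ?b > 1" using f(2) card_field_gt_1[where 'k = 'f] by (intro one_less_power)
  have "k > 0 \<and> card (carrier V) = ?q ^ (?b * k) \<longleftrightarrow> ?N 1 = ?q ^ ?b"
  proof
    assume L: "k > 0 \<and> card (carrier V) = ?q ^ (?b * k)"
    have "?N 1 * (?q ^ ?b) ^ j \<le> ?N (Suc j)" if "j < k" for j
      using that
    proof (induction j)
      case (Suc j)
      have "?N 1 * (?q ^ ?b) ^ Suc j = ?q ^ ?b * (?N 1 * (?q ^ ?b) ^ j)" by simp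
      also have "\<dots> \<le> ?q ^ ?b * ?N (Suc j)" using Suc by (intro mult_le_mono2) auto
      also have "\<dots> \<le> ?N (Suc (Suc j))" using Suc.prems by (rule low)
      finally show ?case .
    qed simp
    from this[of "k - 1"] have "?N 1 * (?q ^ ?b) ^ (k - 1) \<le> ?q ^ (?b * k)" using L Nk by simp
    also have "\<dots> = ?q ^ ?b * (?q ^ ?b) ^ (k - 1)"
      using L by (metis One_nat_def Suc_pred power_Suc power_mult)
    finally have "?N 1 \<le> ?q ^ ?b" by simp
    moreover have "?q ^ ?b \<le> ?N 1" using low[of 0] L N0 by simp
    ultimately show "?N 1 = ?q ^ ?b" by simp
  next
    assume R: "?N 1 = ?q ^ ?b"
    have le: "?N j \<le> (?q ^ ?b) ^ j" for j
    proof (induction j)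
      case (Suc j)
      have "?N (Suc j) \<le> ?q ^ ?b * ?N j" using up[of j] R by simp
      also have "\<dots> \<le> ?q ^ ?b * (?q ^ ?b) ^ j" using Suc by (rule mult_le_mono2)
      finally show ?case by simp
    qed (use N0 in simp)
    have ge: "(?q ^ ?b) ^ j \<le> ?N j" if "j \<le> k" for j
      using that
    proof (induction j)
      case (Suc j)
      have "(?q ^ ?b) ^ Suc j \<le> ?q ^ ?b * ?N j" using Suc by simp
      also have "\<dots> \<le> ?N (Suc j)" using Suc.prems by (intro low) simp
      finally show ?case .
    qed (use N0 in simp)
    have "k > 0"
    proof (rule ccontr)
      assume "\<not> k > 0"
      then have "card (carrier V) = 1" using Nk N0 by simp
      moreover have "?N 1 \<le> card (carrier V)" by (intro card_mono) auto
      ultimately show False using R q0 by simp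
    qed
    moreover have "card (carrier V) = ?q ^ (?b * k)"
      using le[of k] ge[of k] Nk by (simp add: power_mult)
    ultimately show "k > 0 \<and> card (carrier V) = ?q ^ (?b * k)" by simp
  qed
  then show ?thesis by (simp add: V0 min_eq_char_iff deg)
qed

lemma finite_lin_endo_restrict:
  assumes W: "submodule class_ring W V" "\<And>v. v \<in> W \<Longrightarrow> Y v \<in> W"
  shows "finite_lin_endo (V\<lparr>carrier := W\<rparr>) Y"
    and "v \<in> W \<Longrightarrow> poly_endo (V\<lparr>carrier := W\<rparr>) p Y v = act p v"
proof -
  have sub: "W \<subseteq> carrier V" using W(1) by (simp add: submodule_def)
  have "vectorspace class_ring (V\<lparr>carrier := W\<rparr>)"
    by (rule subspace_is_vs) (use W(1) in \<open>simp add: subspace_def vectorspace_axioms\<close>)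
  then show fle: "finite_lin_endo (V\<lparr>carrier := W\<rparr>) Y"
    unfolding finite_lin_endo_def lin_endo_def lin_endo_axioms_def finite_lin_endo_axioms_def
    using sub W(2) finite_subset[OF sub fin] by (auto simp: module_hom_def Y_add Y_smult subset_iff)
  interpret W: finite_lin_endo "V\<lparr>carrier := W\<rparr>" Y by (rule fle)
  show "poly_endo (V\<lparr>carrier := W\<rparr>) p Y v = act p v" if v: "v \<in> W"
  proof (induction p)
    case 0
    then show ?case using W.act_0[of v] act_0[of v] v sub by auto
  next
    case (pCons a p)
    then show ?case using W.act_pCons[of v a p] act_pCons[of v a p] v sub by auto
  qed
qed

text \<open>The primary component is the kernel of a power of \<open>f\<close>, and it contains the kernel of \<open>f\<close>: the
  exponent is the dimension of \<open>V\<close>, which is positive unless \<open>V\<close> is trivial.\<close>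
lemma primary_cyclic_iff_card_ker:
  assumes f: "irreducible f" "degree f > 0"
  shows "primary_cyclic V f Y \<longleftrightarrow> card (ker f) = CARD('f) ^ degree f"
proof -
  let ?W = "primary_component V f Y"
  have W: "?W = ker (f ^ dim)"
    unfolding primary_component_def by (auto simp: act_power)
  have sub: "submodule class_ring ?W V" unfolding W by (rule ker_submodule)
  have inv: "Y v \<in> ?W" if "v \<in> ?W" for v
  proof -
    have "v \<in> carrier V" "act (f ^ dim) v = \<zero>\<^bsub>V\<^esub>" using that unfolding W by auto
    moreover from this have "act [:0, 1:] v = Y v" by (simp add: act_pCons smult_distr)
    ultimately show ?thesis unfolding W using act_comm[of v "f ^ dim" "[:0, 1:]"] by simp
  qed
  interpret W: finite_lin_endo "V\<lparr>carrier := ?W\<rparr>" Y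
    by (rule finite_lin_endo_restrict(1)[OF sub inv])
  have act_W: "W.act p v = act p v" if "v \<in> ?W" for p v
    by (rule finite_lin_endo_restrict(2)[OF sub inv that])
  have annW: "W.ann (f ^ dim)" using act_W by (simp add: W)
  have kerW: "W.ker f = ker f"
  proof (cases "dim = 0")
    case True
    then have "card (carrier V) = 1" using card_carrier_eq_dim by simp
    then have c: "carrier V = {\<zero>\<^bsub>V\<^esub>}" using M.zero_closed by (metis card_1_singletonE singletonD)
    have "?W = {\<zero>\<^bsub>V\<^esub>}" unfolding W using c by auto
    then show ?thesis using act_W c by auto
  next
    case False
    have "v \<in> ?W" if "v \<in> ker f" for v
    proof -
      have "f ^ dim = f ^ (dim - 1) * f" using False by (metis mult.commute power_eq_if)
      then show ?thesis unfolding W using that by (simp add: act_mult)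
    qed
    moreover have "?W \<subseteq> carrier V" unfolding W by auto
    ultimately show ?thesis using act_W by auto
  qed
  show ?thesis
    unfolding primary_cyclic_def using W.cyclic_iff_card_ker[OF f annW] kerW by simp
qed

end

context finite_lin_endo
begin

lemma ker_linear_factor: "ker [:- a, 1:] = {v \<in> carrier V. Y v = a \<odot>\<^bsub>V\<^esub> v}"
proof -
  have "act [:- a, 1:] v = Y v \<ominus>\<^bsub>V\<^esub> a \<odot>\<^bsub>V\<^esub> v" if v: "v \<in> carrier V" for v
  proof -
    have "[:- a, 1:] = [:0, 1:] - [:a:]" by simp
    then have "act [:- a, 1:] v = act [:0, 1:] v \<ominus>\<^bsub>V\<^esub> act [:a:] v" using act_diff[OF v] by metis
    also have "act [:0, 1:] v = Y v" using v by (simp add: act_pCons smult_distr)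
    also have "act [:a:] v = a \<odot>\<^bsub>V\<^esub> v" using v by (simp add: act_pCons smult_distr)
    finally show ?thesis .
  qed
  then show ?thesis by (auto simp: diff_eq_zero)
qed

text \<open>Distinct linear factors are coprime, so the kernel of the product splits; each linear factor
  contributes an eigenspace.\<close>
lemma card_ker_prod_linear:
  assumes "finite S"
  shows "card (ker (\<Prod>a\<in>S. [:- a, 1:])) = (\<Prod>a\<in>S. card {v \<in> carrier V. Y v = a \<odot>\<^bsub>V\<^esub> v})"
  using assms
proof (induction S)
  case empty
  have "ker 1 = {\<zero>\<^bsub>V\<^esub>}" by auto
  then show ?case by simp
next
  case (insert a S)
  have "poly (\<Prod>a\<in>S. [:- a, 1:]) a \<noteq> 0" using insert.hyps by (auto simp: poly_prod)
  then have "\<not> [:- a, 1:] dvd (\<Prod>a\<in>S. [:- a, 1:])" by (simp only: poly_eq_0_iff_dvd not_False_eq_True)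
  then obtain s t where "s * (\<Prod>a\<in>S. [:- a, 1:]) + t * [:- a, 1:] = 1"
    using irreducible_bezout[of "[:- a, 1:]"] irreducible_linear_field_poly[of 1 "- a"]
    by (metis one_neq_zero)
  then have "t * [:- a, 1:] + s * (\<Prod>a\<in>S. [:- a, 1:]) = 1" by (simp only: add.commute)
  from card_ker_coprime[OF this] show ?case
    using insert by (simp add: ker_linear_factor)
qed

end

section \<open>Interpolation at powers of the field size\<close>

text \<open>The Newton basis polynomials at the nodes \<open>Q ^ i\<close>; at the size of a space over a field with \<open>Q\<close>
  elements, the number of independent lists of length \<open>e\<close> in that space.\<close>
definition newton :: "real \<Rightarrow> nat \<Rightarrow> real \<Rightarrow> real" where
  "newton Q e x = (\<Prod>i<e. x - Q ^ i)"

lemma newton_0 [simp]: "newton Q 0 x = 1" and newton_Suc: "newton Q (Suc e) x = newton Q e x * (x - Q ^ e)"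
  by (simp_all add: newton_def)

lemma newton_eq_0: "d < e \<Longrightarrow> newton Q e (Q ^ d) = 0"
  by (auto simp: newton_def)

lemma newton_Suc_scaled: "newton Q (Suc e) (Q * x) = (Q * x - 1) * Q ^ e * newton Q e x"
proof -
  have "newton Q (Suc e) (Q * x) = (Q * x - 1) * (\<Prod>i<e. Q * x - Q ^ Suc i)"
    unfolding newton_def by (subst prod.lessThan_Suc_shift) simp
  also have "(\<Prod>i<e. Q * x - Q ^ Suc i) = (\<Prod>i<e. Q * (x - Q ^ i))"
    by (intro prod.cong) (auto simp: algebra_simps)
  also have "\<dots> = Q ^ e * newton Q e x"
    by (simp add: newton_def prod.distrib)
  finally show ?thesis by simp
qed

text \<open>The Newton coefficients of the indicators of \<open>d = 0\<close> and \<open>d = 1\<close> as functions of \<open>Q ^ d\<close>.\<close>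
definition zero_coeff :: "real \<Rightarrow> nat \<Rightarrow> real" where
  "zero_coeff Q e = (-1) ^ e / (\<Prod>i<e. Q ^ Suc i - 1)"

definition one_coeff :: "real \<Rightarrow> nat \<Rightarrow> real" where
  "one_coeff Q e = (case e of 0 \<Rightarrow> 0 | Suc k \<Rightarrow> zero_coeff Q k / (Q ^ k * (Q - 1)))"

lemma zero_coeff_partial_sum:
  assumes "Q > 1"
  shows "(\<Sum>e\<le>m. zero_coeff Q e * newton Q e x) = (\<Prod>i<m. (Q ^ Suc i - x) / (Q ^ Suc i - 1))"
proof (induction m)
  case 0
  show ?case by (simp add: zero_coeff_def)
next
  case (Suc m)
  have nz: "Q ^ Suc i - 1 \<noteq> 0" for i
    using one_less_power[OF assms, of "Suc i"] by simp
  let ?D = "\<Prod>i<m. Q ^ Suc i - 1"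
  let ?P = "\<Prod>i<m. (Q ^ Suc i - x) / (Q ^ Suc i - 1)"
  have P: "?P = (-1) ^ m * (\<Prod>i<m. x - Q ^ Suc i) / ?D"
  proof -
    have "(\<Prod>i<m. Q ^ Suc i - x) = (\<Prod>i<m. (-1) * (x - Q ^ Suc i))" by (intro prod.cong) auto
    also have "\<dots> = (-1) ^ m * (\<Prod>i<m. x - Q ^ Suc i)" by (subst prod.distrib) simp
    finally show ?thesis by (simp add: prod_dividef)
  qed
  have n: "newton Q (Suc m) x = (x - 1) * (\<Prod>i<m. x - Q ^ Suc i)"
    unfolding newton_def by (subst prod.lessThan_Suc_shift) simp
  have "zero_coeff Q (Suc m) * newton Q (Suc m) x = ?P * (1 - x) / (Q ^ Suc m - 1)"
  proof -
    have "- s / (D * E) * ((x - 1) * R) = s * R / D * (1 - x) / E" for s D E R :: real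
      by (simp add: divide_inverse algebra_simps)
    from this[of "(-1) ^ m" ?D "Q ^ Suc m - 1"] show ?thesis
      unfolding n P zero_coeff_def by simp
  qed
  then have "(\<Sum>e\<le>Suc m. zero_coeff Q e * newton Q e x) = ?P * (1 + (1 - x) / (Q ^ Suc m - 1))"
    using Suc.IH by (simp add: algebra_simps)
  also have "1 + (1 - x) / (Q ^ Suc m - 1) = (Q ^ Suc m - x) / (Q ^ Suc m - 1)"
    using nz[of m] by (simp add: field_simps)
  finally show ?case by simp
qed

lemma zero_coeff_indicator:
  assumes "Q > 1" "d \<le> m"
  shows "(\<Sum>e\<le>m. zero_coeff Q e * newton Q e (Q ^ d)) = of_bool (d = 0)"
proof (cases d)
  case 0
  have nz: "Q ^ Suc i - 1 \<noteq> 0" for i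
    using one_less_power[OF assms(1), of "Suc i"] by simp
  have "(\<Prod>i<m. (Q ^ Suc i - 1) / (Q ^ Suc i - 1)) = 1"
    by (intro prod.neutral) (use nz in auto)
  then show ?thesis
    using 0 by (simp add: zero_coeff_partial_sum[OF assms(1)] del: power_Suc)
next
  case (Suc d')
  then have "\<exists>i\<in>{..<m}. (Q ^ Suc i - Q ^ d) / (Q ^ Suc i - 1) = 0"
    using assms(2) by (intro bexI[of _ d']) auto
  then have "(\<Prod>i<m. (Q ^ Suc i - Q ^ d) / (Q ^ Suc i - 1)) = 0"
    by (intro prod_zero) (simp_all del: power_Suc)
  then show ?thesis
    using Suc by (simp add: zero_coeff_partial_sum[OF assms(1)] del: power_Suc)
qed

text \<open>Scaling the argument by \<open>Q\<close> shifts the nodes, which reduces this to the indicator of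
  \<open>d = 0\<close>.\<close>
lemma one_coeff_indicator:
  assumes "Q > 1" "d \<le> m"
  shows "(\<Sum>e\<le>m. one_coeff Q e * newton Q e (Q ^ d)) = of_bool (d = 1)"
proof (cases m)
  case 0
  then show ?thesis using assms(2) by (simp add: one_coeff_def)
next
  case (Suc m')
  have "(\<Sum>e\<le>m. one_coeff Q e * newton Q e (Q ^ d))
      = (\<Sum>e\<le>m'. zero_coeff Q e / (Q ^ e * (Q - 1)) * newton Q (Suc e) (Q ^ d))"
    unfolding Suc by (subst sum.atMost_Suc_shift) (simp add: one_coeff_def)
  also have "\<dots> = of_bool (d = 1)"
  proof (cases d)
    case 0
    then show ?thesis using newton_eq_0[of 0 _ Q] by simp
  next
    case (Suc d')
    have "zero_coeff Q e / (Q ^ e * (Q - 1)) * newton Q (Suc e) (Q ^ d)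
        = (Q ^ d - 1) / (Q - 1) * (zero_coeff Q e * newton Q e (Q ^ d'))" for e
      using assms(1) unfolding Suc power_Suc newton_Suc_scaled by simp
    then have "(\<Sum>e\<le>m'. zero_coeff Q e / (Q ^ e * (Q - 1)) * newton Q (Suc e) (Q ^ d))
        = (Q ^ d - 1) / (Q - 1) * (\<Sum>e\<le>m'. zero_coeff Q e * newton Q e (Q ^ d'))"
      by (simp add: sum_distrib_left)
    also have "\<dots> = of_bool (d = 1)"
      using assms \<open>m = Suc m'\<close> Suc by (subst zero_coeff_indicator) auto
    finally show ?thesis .
  qed
  finally show ?thesis .
qed

lemma prod_shifted_powers_ge:
  fixes Q :: real
  assumes "Q \<ge> 4"
  shows "(\<Prod>i<e. Q ^ Suc i - 1) \<ge> 3 ^ e"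
proof -
  have "3 \<le> Q ^ Suc i - 1" for i
  proof -
    have "Q ^ 1 \<le> Q ^ Suc i" using assms by (intro power_increasing) auto
    then have "Q \<le> Q ^ Suc i" by (simp only: power_one_right)
    with assms show ?thesis by linarith
  qed
  then have "(\<Prod>i<e. 3) \<le> (\<Prod>i<e. Q ^ Suc i - 1)"
    by (intro prod_mono) auto
  then show ?thesis by simp
qed

text \<open>The ratio of the terms at \<open>e + 1\<close> and \<open>e\<close> is \<open>Q / (Q ^ (e + 1) - 1)\<close>, at most \<open>4/3\<close> for
  \<open>e = 0\<close> and at most \<open>1/2\<close> from then on.\<close>
lemma zero_coeff_abs_le:
  assumes "Q \<ge> 4"
  shows "\<bar>zero_coeff Q e\<bar> * Q ^ e \<le> 8 / 3 * (1 / 2) ^ e"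
proof (induction e)
  case 0
  show ?case by (simp add: zero_coeff_def)
next
  case (Suc e)
  have pos: "Q ^ Suc i - 1 > 0" for i
    using assms one_less_power[of Q "Suc i"] by simp
  have step: "\<bar>zero_coeff Q (Suc e)\<bar> * Q ^ Suc e = \<bar>zero_coeff Q e\<bar> * Q ^ e * (Q / (Q ^ Suc e - 1))"
    using pos[of e] by (simp add: zero_coeff_def abs_mult)
  show ?case
  proof (cases e)
    case 0
    then show ?thesis using assms by (simp add: step zero_coeff_def field_simps)
  next
    case (Suc e')
    have "Q ^ 2 \<le> Q ^ Suc e" using assms Suc by (intro power_increasing) auto
    moreover have "4 * Q \<le> Q ^ 2" using assms by (simp add: power2_eq_square)
    ultimately have "2 * Q \<le> Q ^ Suc e - 1" using assms by linarith
    then have "Q / (Q ^ Suc e - 1) \<le> 1 / 2" using pos[of e] by (simp add: field_simps)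
    then have "\<bar>zero_coeff Q e\<bar> * Q ^ e * (Q / (Q ^ Suc e - 1)) \<le> 8 / 3 * (1 / 2) ^ e * (1 / 2)"
      by (rule mult_mono[OF Suc.IH]) (use assms pos[of e] in auto)
    then show ?thesis unfolding step by simp
  qed
qed

lemma one_coeff_abs_le:
  assumes "Q \<ge> 4"
  shows "\<bar>one_coeff Q e\<bar> * Q ^ e \<le> 8 / 3 * (1 / 2) ^ e"
proof (cases e)
  case 0
  then show ?thesis by (simp add: one_coeff_def)
next
  case (Suc k)
  let ?D = "\<Prod>i<k. Q ^ Suc i - 1"
  have D: "?D \<ge> 2 ^ k"
    using prod_shifted_powers_ge[OF assms, of k] power_mono[of "2::real" 3 k] by (simp del: power_Suc)
  have D': "?D > 0"
    using D zero_less_power[of "2::real" k] by linarith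
  have "\<bar>one_coeff Q e\<bar> * Q ^ e = Q / (Q - 1) * (1 / ?D)"
    using assms D' by (simp add: Suc one_coeff_def zero_coeff_def abs_mult)
  also have "\<dots> \<le> 4 / 3 * (1 / 2 ^ k)"
    using assms D D' by (intro mult_mono divide_left_mono) (auto simp: field_simps)
  finally show ?thesis by (simp add: Suc power_one_over)
qed

lemma sum_abs_coeff_le:
  fixes a :: "nat \<Rightarrow> real"
  assumes "\<And>e. \<bar>a e\<bar> * Q ^ e \<le> 8 / 3 * (1 / 2) ^ e"
  shows "(\<Sum>e\<le>m. \<bar>a e\<bar> * Q ^ e) \<le> 16 / 3"
proof -
  have "(\<Sum>e\<le>m. \<bar>a e\<bar> * Q ^ e) \<le> (\<Sum>e\<le>m. 8 / 3 * (1 / 2) ^ e)"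
    by (intro sum_mono assms)
  also have "\<dots> = 8 / 3 * (\<Sum>e\<le>m. (1 / 2) ^ e)" by (simp only: sum_distrib_left)
  also have "(\<Sum>e\<le>m. (1 / 2 :: real) ^ e) \<le> 2"
    by (subst sum_gp0) auto
  finally show ?thesis by simp
qed

text \<open>The probability that \<open>k\<close> random vectors of length \<open>c\<close> over a field with \<open>Q\<close> elements are
  independent.\<close>
definition indep_probability :: "nat \<Rightarrow> nat \<Rightarrow> nat \<Rightarrow> real" where
  "indep_probability Q c k = (\<Prod>i<k. 1 - real Q ^ i / real Q ^ c)"

lemma indep_probability_bounds:
  assumes "Q \<ge> 2"
  shows "indep_probability Q c k \<ge> 0" "indep_probability Q c k \<le> 1" "1 - indep_probability Q c k \<le> real Q ^ k / real Q ^ c"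
proof -
  have big: "indep_probability Q c k = 0" if "k > c"
    unfolding indep_probability_def using that assms by (intro prod_zero) (auto intro!: bexI[of _ c])
  have small: "0 \<le> indep_probability Q c k \<and> indep_probability Q c k \<le> 1" if "k \<le> c"
  proof -
    have "real Q ^ i / real Q ^ c \<le> 1" if "i < k" for i
      using that \<open>k \<le> c\<close> assms power_increasing[of i c "real Q"] by simp
    then show ?thesis unfolding indep_probability_def by (auto intro!: prod_nonneg prod_le_1)
  qed
  show b: "indep_probability Q c k \<ge> 0" "indep_probability Q c k \<le> 1" using big small by force+
  show "1 - indep_probability Q c k \<le> real Q ^ k / real Q ^ c"
  proof (cases "k \<le> c")
    case False
    then show ?thesis using big assms power_increasing[of c k "real Q"] by simp
  next
    case True
    then show ?thesis
    proof (induction k)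
      case 0
      show ?case by (simp add: indep_probability_def)
    next
      case (Suc k)
      have IH: "1 - indep_probability Q c k \<le> real Q ^ k / real Q ^ c" using Suc by simp
      have "indep_probability Q c k \<le> 1"
        unfolding indep_probability_def using Suc.prems assms
        by (intro prod_le_1) (auto simp: power_increasing)
      have "1 - indep_probability Q c (Suc k) = 1 - indep_probability Q c k + indep_probability Q c k * (real Q ^ k / real Q ^ c)"
        by (simp add: indep_probability_def algebra_simps)
      also have "\<dots> \<le> real Q ^ k / real Q ^ c + 1 * (real Q ^ k / real Q ^ c)"
        using IH \<open>indep_probability Q c k \<le> 1\<close> by (intro add_mono mult_right_mono) auto
      also have "\<dots> = 2 * real Q ^ k / real Q ^ c" by simp
      also have "\<dots> \<le> real Q ^ Suc k / real Q ^ c"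
        using assms by (intro divide_right_mono) auto
      finally show ?case .
    qed
  qed
qed

text \<open>Both values lie in the interval from \<open>1 - Q ^ k / Q ^ c\<close> to 1.\<close>
lemma indep_probability_diff_le:
  assumes "Q \<ge> 2" "c \<le> c'"
  shows "\<bar>indep_probability Q c k - indep_probability Q c' k\<bar> \<le> real Q ^ k / real Q ^ c"
proof -
  have "real Q ^ k / real Q ^ c' \<le> real Q ^ k / real Q ^ c"
    using assms by (intro divide_left_mono power_increasing) auto
  then show ?thesis
    using indep_probability_bounds[OF assms(1), of c k] indep_probability_bounds[OF assms(1), of c' k] by linarith
qed

section \<open>Linearly independent lists of eigenvectors over a finite field\<close>

lemma card_carrier_vec: "card (carrier_vec n :: 'k::finite vec set) = CARD('k) ^ n"
  and finite_carrier_vec [simp]: "finite (carrier_vec n :: 'k::finite vec set)"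
proof -
  have "bij_betw vec_of_list {xs :: 'k list. set xs \<subseteq> UNIV \<and> length xs = n} (carrier_vec n)"
  proof (rule bij_betwI[where g = list_of_vec])
    show "vec_of_list \<in> {xs :: 'k list. set xs \<subseteq> UNIV \<and> length xs = n} \<rightarrow> carrier_vec n"
      by (intro funcsetI carrier_vecI) simp
    show "list_of_vec \<in> carrier_vec n \<rightarrow> {xs :: 'k list. set xs \<subseteq> UNIV \<and> length xs = n}"
      by (intro funcsetI) simp
  qed (simp_all only: list_vec vec_list)
  note b = bij_betw_same_card[OF this] bij_betw_finite[OF this]
  show "card (carrier_vec n :: 'k vec set) = CARD('k) ^ n"
    using b(1) card_lists_length_eq[of "UNIV :: 'k set" n] by simp
  show "finite (carrier_vec n :: 'k vec set)"
    using b(2) finite_lists_length_eq[of "UNIV :: 'k set" n] by simp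
qed

lemma card_field_lists: "card {as :: 'k::finite list. length as = e} = CARD('k) ^ e"
  and finite_field_lists: "finite {as :: 'k::finite list. length as = e}"
  using card_lists_length_eq[of "UNIV :: 'k set" e] finite_lists_length_eq[of "UNIV :: 'k set" e]
  by simp_all

fun lin_comb :: "nat \<Rightarrow> 'k::field list \<Rightarrow> 'k vec list \<Rightarrow> 'k vec" where
  "lin_comb n (a # as) (v # vs) = a \<cdot>\<^sub>v v + lin_comb n as vs"
| "lin_comb n _ _ = 0\<^sub>v n"

lemma lin_comb_carrier [simp]: "set vs \<subseteq> carrier_vec n \<Longrightarrow> lin_comb n as vs \<in> carrier_vec n"
  by (induction n as vs rule: lin_comb.induct) auto

lemma lin_comb_smult:
  "set vs \<subseteq> carrier_vec n \<Longrightarrow> lin_comb n (map ((*) c) as) vs = c \<cdot>\<^sub>v lin_comb n as vs"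
  by (induction n as vs rule: lin_comb.induct)
    (auto simp: smult_add_distrib_vec[where n = n for n] smult_smult_assoc)

lemma lin_comb_minus:
  assumes "set vs \<subseteq> carrier_vec n" "length as = length vs" "length bs = length vs"
  shows "lin_comb n (map2 (-) as bs) vs = lin_comb n as vs - lin_comb n bs vs"
  using assms(3,2,1)
proof (induction bs vs arbitrary: as rule: list_induct2)
  case Nil
  then show ?case by auto
next
  case (Cons b bs v vs)
  then obtain a as' where as: "as = a # as'" by (cases as) auto
  have c: "lin_comb n as' vs \<in> carrier_vec n" "lin_comb n bs vs \<in> carrier_vec n" "v \<in> carrier_vec n"
    using Cons.prems by auto
  have "lin_comb n (map2 (-) (a # as') (b # bs)) (v # vs) = (a - b) \<cdot>\<^sub>v v + (lin_comb n as' vs - lin_comb n bs vs)"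
    using Cons by (simp add: as)
  also have "\<dots> = (a \<cdot>\<^sub>v v + lin_comb n as' vs) - (b \<cdot>\<^sub>v v + lin_comb n bs vs)"
    by (rule eq_vecI) (use c in \<open>auto simp: algebra_simps\<close>)
  finally show ?case by (simp add: as)
qed

lemma scalar_prod_lin_comb:
  fixes vs :: "'k::field vec list"
  assumes "r \<in> carrier_vec n" "set vs \<subseteq> carrier_vec n" "\<forall>v\<in>set vs. r \<bullet> v = 0"
  shows "r \<bullet> lin_comb n as vs = 0"
  using assms
  by (induction n as vs rule: lin_comb.induct) (auto simp: scalar_prod_add_distrib[where n = n for n])

lemma mult_mat_lin_comb:
  fixes vs :: "'k::field vec list"
  assumes "A \<in> carrier_mat n n" "set vs \<subseteq> carrier_vec n"
  shows "A *\<^sub>v lin_comb n as vs = lin_comb n as (map ((*\<^sub>v) A) vs)"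
  using assms
  by (induction as vs rule: list_induct2')
    (auto simp: mult_add_distrib_mat_vec[of A n n] mult_mat_vec[of A n n])

lemma lin_comb_eigen:
  fixes vs :: "'k::field vec list"
  assumes "length as = length vs" "length mus = length vs"
    "list_all2 (\<lambda>mu v. A *\<^sub>v v = mu \<cdot>\<^sub>v v) mus vs"
  shows "lin_comb n as (map ((*\<^sub>v) A) vs) = lin_comb n (map2 (*) as mus) vs"
  using assms
proof (induction as vs arbitrary: mus rule: list_induct2)
  case (Cons a as v vs)
  then obtain mu mus' where "mus = mu # mus'" by (cases mus) auto
  with Cons show ?case by (simp add: smult_smult_assoc)
qed auto

definition indep :: "nat \<Rightarrow> 'k::field vec list \<Rightarrow> bool" where
  "indep n vs \<longleftrightarrow> set vs \<subseteq> carrier_vec n \<and>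
     (\<forall>as. length as = length vs \<longrightarrow> lin_comb n as vs = 0\<^sub>v n \<longrightarrow> as = replicate (length vs) 0)"

definition span_list :: "nat \<Rightarrow> 'k::field vec list \<Rightarrow> 'k vec set" where
  "span_list n vs = (\<lambda>as. lin_comb n as vs) ` {as. length as = length vs}"

lemma indep_carrier: "indep n vs \<Longrightarrow> set vs \<subseteq> carrier_vec n"
  by (simp add: indep_def)

lemma indep_inj:
  assumes "indep n vs"
  shows "inj_on (\<lambda>as. lin_comb n as vs) {as. length as = length vs}"
proof (rule inj_onI, clarsimp)
  fix as bs :: "'a list"
  assume l: "length as = length vs" "length bs = length vs" and eq: "lin_comb n as vs = lin_comb n bs vs"
  have "lin_comb n (map2 (-) as bs) vs = 0\<^sub>v n"
    using l eq lin_comb_minus[OF indep_carrier[OF assms]] lin_comb_carrier[OF indep_carrier[OF assms]] by simp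
  then have z: "map2 (-) as bs = replicate (length vs) 0"
    using assms l by (simp add: indep_def)
  show "as = bs"
  proof (rule nth_equalityI)
    fix i assume i: "i < length as"
    then have "map2 (-) as bs ! i = 0" using z l by simp
    then show "as ! i = bs ! i" using i l by simp
  qed (use l in simp)
qed

lemma card_span_list:
  fixes vs :: "'k::{field,finite} vec list"
  assumes "indep n vs"
  shows "card (span_list n vs) = CARD('k) ^ length vs"
  unfolding span_list_def by (simp add: card_image[OF indep_inj[OF assms]] card_field_lists)

lemma span_list_carrier: "set vs \<subseteq> carrier_vec n \<Longrightarrow> span_list n vs \<subseteq> carrier_vec n"
  by (auto simp: span_list_def)

lemma lin_comb_replicate_0: "set vs \<subseteq> carrier_vec n \<Longrightarrow> lin_comb n (replicate (length vs) 0) vs = 0\<^sub>v n"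
  by (induction vs) auto

lemma span_list_closed:
  assumes "set vs \<subseteq> carrier_vec n"
  shows "0\<^sub>v n \<in> span_list n vs"
    and "u \<in> span_list n vs \<Longrightarrow> v \<in> span_list n vs \<Longrightarrow> u - v \<in> span_list n vs"
    and "u \<in> span_list n vs \<Longrightarrow> c \<cdot>\<^sub>v u \<in> span_list n vs"
proof -
  show "0\<^sub>v n \<in> span_list n vs"
    unfolding span_list_def using lin_comb_replicate_0[OF assms] by (intro image_eqI[of _ _ "replicate (length vs) 0"]) auto
  show "u - v \<in> span_list n vs" if "u \<in> span_list n vs" "v \<in> span_list n vs"
    using that unfolding span_list_def by (auto simp: lin_comb_minus[OF assms, symmetric])
  show "c \<cdot>\<^sub>v u \<in> span_list n vs" if "u \<in> span_list n vs"
    using that unfolding span_list_def by (auto simp: lin_comb_smult[OF assms, symmetric])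
qed

text \<open>Independent lists are built one vector at a time, each new one avoiding the span of those
  already present; this is how they are counted below.\<close>
lemma indep_Cons:
  "indep n (v # vs) \<longleftrightarrow> v \<in> carrier_vec n \<and> indep n vs \<and> v \<notin> span_list n vs"
proof (cases "v \<in> carrier_vec n \<and> set vs \<subseteq> carrier_vec n")
  case False
  then show ?thesis by (auto simp: indep_def)
next
  case True
  then have v: "v \<in> carrier_vec n" and vs: "set vs \<subseteq> carrier_vec n" by auto
  show ?thesis
  proof
    assume ind: "indep n (v # vs)"
    have zero: "a = 0 \<and> as = replicate (length vs) 0"
      if "a \<cdot>\<^sub>v v + lin_comb n as vs = 0\<^sub>v n" "length as = length vs" for a as
    proof -
      have "a # as = replicate (length (v # vs)) 0"
        using ind that unfolding indep_def by (metis length_Cons lin_comb.simps(1))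
      then show ?thesis by simp
    qed
    have "indep n vs"
      unfolding indep_def
    proof (intro conjI allI impI)
      fix as assume "length as = length vs" "lin_comb n as vs = 0\<^sub>v n"
      moreover have "0 \<cdot>\<^sub>v v + 0\<^sub>v n = 0\<^sub>v n" using v by (intro eq_vecI) auto
      ultimately show "as = replicate (length vs) 0" using zero[of 0 as] by simp
    qed (use vs in simp)
    moreover have "v \<notin> span_list n vs"
    proof
      assume "v \<in> span_list n vs"
      then obtain as where "length as = length vs" "v = lin_comb n as vs" by (auto simp: span_list_def)
      then have "(-1) \<cdot>\<^sub>v v + lin_comb n as vs = 0\<^sub>v n" using v by (intro eq_vecI) auto
      with zero \<open>length as = length vs\<close> have "(-1::'a) = 0" by blast
      then show False by simp
    qed
    ultimately show "v \<in> carrier_vec n \<and> indep n vs \<and> v \<notin> span_list n vs" using v by simp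
  next
    assume R: "v \<in> carrier_vec n \<and> indep n vs \<and> v \<notin> span_list n vs"
    show "indep n (v # vs)" unfolding indep_def
    proof (intro conjI allI impI)
      fix bs assume "length bs = length (v # vs)" and z: "lin_comb n bs (v # vs) = 0\<^sub>v n"
      then obtain a as where bs: "bs = a # as" and l: "length as = length vs" by (cases bs) auto
      have lcar: "lin_comb n as vs \<in> carrier_vec n" using vs by simp
      have eq: "a \<cdot>\<^sub>v v + lin_comb n as vs = 0\<^sub>v n" using z bs by simp
      have "a = 0"
      proof (rule ccontr)
        assume a: "a \<noteq> 0"
        have "v = (- 1 / a) \<cdot>\<^sub>v lin_comb n as vs"
        proof (rule eq_vecI)
          fix i assume i: "i < dim_vec ((- 1 / a) \<cdot>\<^sub>v lin_comb n as vs)"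
          then have "(a \<cdot>\<^sub>v v + lin_comb n as vs) $ i = 0" using eq lcar by simp
          then have "a * v $ i + lin_comb n as vs $ i = 0" using i v lcar by simp
          then show "v $ i = ((- 1 / a) \<cdot>\<^sub>v lin_comb n as vs) $ i"
            using a i by (simp add: field_simps eq_neg_iff_add_eq_0)
        qed (use v lcar in simp)
        then have "v \<in> span_list n vs"
          using span_list_closed(3)[OF vs, of "lin_comb n as vs"] l by (auto simp: span_list_def)
        then show False using R by simp
      qed
      moreover from this have "lin_comb n as vs = 0\<^sub>v n"
      proof -
        have "lin_comb n as vs = 0 \<cdot>\<^sub>v v + lin_comb n as vs" using v lcar by (intro eq_vecI) auto
        then show ?thesis using eq \<open>a = 0\<close> by simp
      qed
      ultimately show "bs = replicate (length (v # vs)) 0"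
        using R l bs by (simp add: indep_def)
    qed (use v vs in simp)
  qed
qed

lemma indep_Nil [simp]: "indep n []"
  by (simp add: indep_def)

text \<open>A nonzero functional takes each value equally often: translate its kernel by multiples of a
  vector with value 1.\<close>
lemma card_functional_kernel:
  fixes G :: "'k::{field,finite} vec set" and f :: "'k vec \<Rightarrow> 'k"
  assumes G: "G \<subseteq> carrier_vec n"
    and closed: "\<And>u v. u \<in> G \<Longrightarrow> v \<in> G \<Longrightarrow> u - v \<in> G" "\<And>c u. u \<in> G \<Longrightarrow> c \<cdot>\<^sub>v u \<in> G"
    and f: "\<And>u v. u \<in> G \<Longrightarrow> v \<in> G \<Longrightarrow> f (u - v) = f u - f v" "\<And>c u. u \<in> G \<Longrightarrow> f (c \<cdot>\<^sub>v u) = c * f u"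
    and u: "u \<in> G" "f u \<noteq> 0"
  shows "card {v \<in> G. f v = 0} * CARD('k) = card G"
proof -
  define w where "w = (1 / f u) \<cdot>\<^sub>v u"
  have w: "w \<in> G" "f w = 1" using u by (auto simp: w_def closed f)
  have "bij_betw (\<lambda>(v, a). v - a \<cdot>\<^sub>v w) ({v \<in> G. f v = 0} \<times> UNIV) G"
  proof (rule bij_betwI[where g = "\<lambda>v. (v - f v \<cdot>\<^sub>v w, - f v)"])
    show "(\<lambda>(v, a). v - a \<cdot>\<^sub>v w) \<in> {v \<in> G. f v = 0} \<times> UNIV \<rightarrow> G"
      using w by (auto simp: closed)
    show "(\<lambda>v. (v - f v \<cdot>\<^sub>v w, - f v)) \<in> G \<rightarrow> {v \<in> G. f v = 0} \<times> UNIV"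
      using w by (auto simp: closed f)
    show "(case (v - f v \<cdot>\<^sub>v w, - f v) of (v, a) \<Rightarrow> v - a \<cdot>\<^sub>v w) = v" if "v \<in> G" for v
    proof -
      have "v \<in> carrier_vec n" "w \<in> carrier_vec n" using that w G by auto
      then show ?thesis by (auto intro!: eq_vecI)
    qed
    fix p assume p: "p \<in> {v \<in> G. f v = 0} \<times> (UNIV :: 'k set)"
    obtain v a where va: "p = (v, a)" by (cases p)
    have "f (v - a \<cdot>\<^sub>v w) = - a" using p va w by (simp add: closed f)
    moreover have "v \<in> carrier_vec n" "w \<in> carrier_vec n" using p va w G by auto
    then have "v - a \<cdot>\<^sub>v w - (- a) \<cdot>\<^sub>v w = v" by (auto intro!: eq_vecI)
    ultimately show "(\<lambda>v. (v - f v \<cdot>\<^sub>v w, - f v)) (case p of (v, a) \<Rightarrow> v - a \<cdot>\<^sub>v w) = p"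
      using va by simp
  qed
  from bij_betw_same_card[OF this] show ?thesis by (simp add: card_cartesian_product)
qed

lemma scalar_prod_minus_right:
  fixes r :: "'k::field vec"
  assumes "r \<in> carrier_vec n" "u \<in> carrier_vec n" "v \<in> carrier_vec n"
  shows "r \<bullet> (u - v) = r \<bullet> u - r \<bullet> v"
  using assms by (simp add: scalar_prod_def sum_subtractf right_diff_distrib)

lemma scalar_prod_minus_left:
  fixes r :: "'k::field vec"
  assumes "r \<in> carrier_vec n" "u \<in> carrier_vec n" "v \<in> carrier_vec n"
  shows "(u - v) \<bullet> r = u \<bullet> r - v \<bullet> r"
  using assms by (simp add: scalar_prod_def sum_subtractf left_diff_distrib)

text \<open>Count the pairs \<open>(r, u)\<close> with \<open>r \<bullet> u = 0\<close> in two ways.  A nonzero \<open>u\<close> is orthogonal to a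
  fraction \<open>1 / Q\<close> of all vectors, and a vector \<open>r\<close> outside the orthogonal complement to a fraction
  \<open>1 / Q\<close> of \<open>U\<close>.\<close>
lemma card_perp:
  fixes U :: "'k::{field,finite} vec set"
  assumes U: "U \<subseteq> carrier_vec n" "0\<^sub>v n \<in> U"
    and closed: "\<And>u v. u \<in> U \<Longrightarrow> v \<in> U \<Longrightarrow> u - v \<in> U" "\<And>c u. u \<in> U \<Longrightarrow> c \<cdot>\<^sub>v u \<in> U"
  shows "card {r \<in> carrier_vec n. \<forall>u\<in>U. r \<bullet> u = 0} * card U = CARD('k) ^ n"
proof -
  let ?C = "carrier_vec n :: 'k vec set" and ?Q = "real CARD('k)"
  let ?P = "{r \<in> ?C. \<forall>u\<in>U. r \<bullet> u = 0}"
  have finU: "finite U" using U(1) finite_subset by fastforce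
  have Q: "?Q > 1" using card_field_gt_1[where 'k = 'k] by simp
  have col: "?Q * card {r \<in> ?C. r \<bullet> u = 0} = (if u = 0\<^sub>v n then ?Q * ?Q ^ n else ?Q ^ n)"
    if "u \<in> U" for u
  proof (cases "u = 0\<^sub>v n")
    case True
    then have "{r \<in> ?C. r \<bullet> u = 0} = ?C" by auto
    then show ?thesis using True by (simp add: card_carrier_vec)
  next
    case False
    have u: "u \<in> ?C" using that U by auto
    obtain i where i: "i < n" "u $ i \<noteq> 0"
      using False u by (metis carrier_vecD eq_vecI index_zero_vec(1) index_zero_vec(2))
    have "card {r \<in> ?C. r \<bullet> u = 0} * CARD('k) = card ?C"
    proof (rule card_functional_kernel[where u = "unit_vec n i"])
      show "unit_vec n i \<bullet> u \<noteq> 0" using i u by simp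
    qed (use u in \<open>auto simp: scalar_prod_minus_left[where n = n]\<close>)
    then have "real (card {r \<in> ?C. r \<bullet> u = 0} * CARD('k)) = ?Q ^ n" by (simp add: card_carrier_vec)
    then show ?thesis using False by (simp add: mult.commute)
  qed
  have row: "?Q * card {u \<in> U. r \<bullet> u = 0} = (if r \<in> ?P then ?Q * card U else card U)" if r: "r \<in> ?C" for r
  proof (cases "r \<in> ?P")
    case True
    then have "{u \<in> U. r \<bullet> u = 0} = U" by auto
    then show ?thesis using True by simp
  next
    case False
    then obtain u where u: "u \<in> U" "r \<bullet> u \<noteq> 0" using r by auto
    have "card {u \<in> U. r \<bullet> u = 0} * CARD('k) = card U"
      by (rule card_functional_kernel[where u = u and n = n])
        (use u U r closed in \<open>auto simp: subset_iff scalar_prod_minus_right[where n = n]\<close>)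
    then have "real (card {u \<in> U. r \<bullet> u = 0} * CARD('k)) = card U" by simp
    then show ?thesis by (subst if_not_P[OF False]) (simp add: mult.commute)
  qed
  have "(\<Sum>r\<in>?C. card {u \<in> U. r \<bullet> u = 0}) = (\<Sum>u\<in>U. card {r \<in> ?C. r \<bullet> u = 0})"
    using sum.swap_restrict[of ?C U "\<lambda>_ _. 1 :: nat" "\<lambda>(r :: 'k vec) u. r \<bullet> u = 0"] finU by simp
  then have "(\<Sum>r\<in>?C. ?Q * card {u \<in> U. r \<bullet> u = 0}) = (\<Sum>u\<in>U. ?Q * card {r \<in> ?C. r \<bullet> u = 0})"
    by (simp add: sum_distrib_left[symmetric] flip: of_nat_sum)
  moreover have "(\<Sum>r\<in>?C. ?Q * card {u \<in> U. r \<bullet> u = 0})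
      = card ?P * ?Q * card U + (?Q ^ n - card ?P) * card U"
  proof -
    have "(\<Sum>r\<in>?C. ?Q * card {u \<in> U. r \<bullet> u = 0}) = (\<Sum>r\<in>?C. if r \<in> ?P then ?Q * card U else card U)"
      using row by (intro sum.cong) auto
    also have "\<dots> = (\<Sum>r\<in>?C. card U + (if r \<in> ?P then (?Q - 1) * card U else 0))"
      by (intro sum.cong) (auto simp: algebra_simps)
    also have "\<dots> = ?Q ^ n * card U + card ?P * ((?Q - 1) * card U)"
      by (subst sum.distrib, subst sum.If_cases)
        (auto simp: card_carrier_vec intro!: arg_cong[where f = card])
    finally show ?thesis by (simp add: algebra_simps)
  qed
  moreover have "(\<Sum>u\<in>U. ?Q * card {r \<in> ?C. r \<bullet> u = 0}) = (?Q - 1) * ?Q ^ n + card U * ?Q ^ n"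
  proof -
    have "(\<Sum>u\<in>U. ?Q * card {r \<in> ?C. r \<bullet> u = 0}) = (\<Sum>u\<in>U. ?Q ^ n + (if u = 0\<^sub>v n then (?Q - 1) * ?Q ^ n else 0))"
      using col by (intro sum.cong) (auto simp: algebra_simps)
    also have "\<dots> = (?Q - 1) * ?Q ^ n + card U * ?Q ^ n"
      using finU U(2) by (simp add: sum.distrib)
    finally show ?thesis .
  qed
  ultimately have "(?Q - 1) * (card ?P * card U) = (?Q - 1) * ?Q ^ n"
    by (simp add: algebra_simps)
  then have "real (card ?P * card U) = real (CARD('k) ^ n)" using Q by simp
  then show ?thesis using of_nat_eq_iff by blast
qed

lemma sum_card_swap:
  assumes "finite A" "finite B"
  shows "(\<Sum>x\<in>A. card {y \<in> B. P x y}) = (\<Sum>y\<in>B. card {x \<in> A. P x y})"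
  using sum.swap_restrict[OF assms, of "\<lambda>_ _. 1 :: nat" P] by simp

text \<open>No fibre of the map sending \<open>r\<close> to its scalar products with \<open>vs\<close> is larger than the orthogonal complement of the span, and the
  \<open>Q ^ length vs\<close> fibres exhaust the space.  By \<open>card_perp\<close> this leaves no room for any fibre to be
  smaller.\<close>
lemma card_scalar_prod_fibre:
  fixes vs :: "'k::{field,finite} vec list"
  assumes vs: "indep n vs" and ts: "length ts = length vs"
  shows "card {r \<in> carrier_vec n. map (\<lambda>v. r \<bullet> v) vs = ts} * CARD('k) ^ length vs = CARD('k) ^ n"
proof -
  let ?C = "carrier_vec n :: 'k vec set"
  let ?F = "\<lambda>ts. {r \<in> ?C. map (\<lambda>v. r \<bullet> v) vs = ts}"
  let ?L = "{ts :: 'k list. length ts = length vs}"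
  let ?P = "{r \<in> ?C. \<forall>u\<in>span_list n vs. r \<bullet> u = 0}"
  have vsC: "set vs \<subseteq> ?C" by (rule indep_carrier[OF vs])
  have P: "card ?P * CARD('k) ^ length vs = CARD('k) ^ n"
    unfolding card_span_list[OF vs, symmetric]
    by (rule card_perp) (use span_list_closed[OF vsC] span_list_carrier[OF vsC] in auto)
  have le: "card (?F ts) \<le> card ?P" for ts
  proof (cases "?F ts = {}")
    case False
    then obtain r0 where r0: "r0 \<in> ?C" "map (\<lambda>v. r0 \<bullet> v) vs = ts" by auto
    have "r - r0 \<in> ?P" if r: "r \<in> ?F ts" for r
    proof -
      have "\<forall>v\<in>set vs. (r - r0) \<bullet> v = 0"
      proof
        fix v assume v: "v \<in> set vs"
        have "r \<bullet> v = r0 \<bullet> v" using v r r0(2) by (metis (mono_tags, lifting) map_eq_conv mem_Collect_eq)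
        then show "(r - r0) \<bullet> v = 0" using v vsC r r0 by (simp add: scalar_prod_minus_left[where n = n] subset_iff)
      qed
      then show ?thesis using r r0 vsC by (auto simp: span_list_def scalar_prod_lin_comb)
    qed
    moreover have "inj_on (\<lambda>r. r - r0) (?F ts)"
    proof (rule inj_onI)
      fix r s assume rs: "r \<in> ?F ts" "s \<in> ?F ts" and e: "r - r0 = s - r0"
      have "r = (r - r0) + r0" using rs r0 by (auto intro!: eq_vecI)
      also have "\<dots> = s" unfolding e using rs r0 by (auto intro!: eq_vecI)
      finally show "r = s" .
    qed
    ultimately show ?thesis by (intro card_inj_on_le[of "\<lambda>r. r - r0"]) auto
  next
    case True
    then show ?thesis by (simp only: card.empty le0)
  qed
  have "(\<Sum>ts\<in>?L. card (?F ts)) = (\<Sum>r\<in>?C. card {ts \<in> ?L. map (\<lambda>v. r \<bullet> v) vs = ts})"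
    by (rule sum_card_swap) (simp_all add: finite_field_lists)
  also have "\<dots> = (\<Sum>r\<in>?C. 1)"
  proof (rule sum.cong[OF refl])
    fix r
    have "{ts \<in> ?L. map (\<lambda>v. r \<bullet> v) vs = ts} = {map (\<lambda>v. r \<bullet> v) vs}" by auto
    then show "card {ts \<in> ?L. map (\<lambda>v. r \<bullet> v) vs = ts} = 1" by simp
  qed
  also have "\<dots> = (\<Sum>ts\<in>?L. card ?P)" using P by (simp add: card_carrier_vec card_field_lists mult.commute)
  finally have "(\<Sum>ts\<in>?L. card (?F ts)) = (\<Sum>ts\<in>?L. card ?P)" .
  then have "card (?F ts) = card ?P"
    using sum_mono_inv[of "\<lambda>ts. card (?F ts)" ?L "\<lambda>_. card ?P" ts] le ts by (simp add: finite_field_lists)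
  then show ?thesis using P by simp
qed

lemma bij_betw_rows:
  "bij_betw (\<lambda>f. Matrix.mat n m (\<lambda>(i, j). f i $ j)) ({..<n} \<rightarrow>\<^sub>E carrier_vec m) (carrier_mat n m)"
  by (rule bij_betwI[where g = "\<lambda>A. \<lambda>i\<in>{..<n}. row A i"])
    (auto simp: fun_eq_iff PiE_def extensional_def Pi_def restrict_def intro!: eq_matI eq_vecI)

lemma finite_carrier_mat [simp]: "finite (carrier_mat n m :: 'k::finite mat set)"
  using bij_betw_finite[OF bij_betw_rows[of n m, where ?'a = 'k]] by (simp add: finite_PiE)

lemma card_carrier_mat: "card (carrier_mat n m :: 'k::finite mat set) = CARD('k) ^ (n * m)"
  using bij_betw_same_card[OF bij_betw_rows[of n m, where ?'a = 'k]]
  by (simp add: card_PiE card_carrier_vec mult.commute flip: power_mult)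

text \<open>A matrix maps \<open>vs\<close> to \<open>ws\<close> iff each row has prescribed scalar products with \<open>vs\<close>, so the rows
  can be chosen independently.\<close>
lemma card_mat_prescribed:
  fixes vs :: "'k::{field,finite} vec list"
  assumes vs: "indep n vs" and ws: "length ws = length vs" "set ws \<subseteq> carrier_vec n"
  shows "card {A \<in> carrier_mat n n. map (\<lambda>v. A *\<^sub>v v) vs = ws} * (CARD('k) ^ n) ^ length vs = CARD('k) ^ (n * n)"
proof -
  let ?M = "{A \<in> carrier_mat n n. map (\<lambda>v. A *\<^sub>v v) vs = ws}"
  let ?R = "\<lambda>i. {r \<in> carrier_vec n. map (\<lambda>v. r \<bullet> v) vs = map (\<lambda>w. w $ i) ws}"
  let ?g = "\<lambda>f. Matrix.mat n n (\<lambda>(i, j). f i $ j) :: 'k mat"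
  have vsC: "set vs \<subseteq> carrier_vec n" by (rule indep_carrier[OF vs])
  have iff: "map (\<lambda>v. A *\<^sub>v v) vs = ws \<longleftrightarrow> (\<forall>i<n. map (\<lambda>v. row A i \<bullet> v) vs = map (\<lambda>w. w $ i) ws)"
    if A: "A \<in> carrier_mat n n" for A
  proof -
    have "A *\<^sub>v (vs ! j) = ws ! j \<longleftrightarrow> (\<forall>i<n. row A i \<bullet> (vs ! j) = ws ! j $ i)" if "j < length vs" for j
    proof -
      have "ws ! j \<in> carrier_vec n" using ws that by (auto simp: subset_iff)
      then have d: "dim_vec (ws ! j) = n" "dim_row A = n" using A by auto
      show ?thesis
      proof
        assume "A *\<^sub>v (vs ! j) = ws ! j"
        then show "\<forall>i<n. row A i \<bullet> (vs ! j) = ws ! j $ i" using d by (metis index_mult_mat_vec)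
      qed (use d in \<open>auto intro!: eq_vecI\<close>)
    qed
    then show ?thesis using ws(1) by (auto simp: list_eq_iff_nth_eq)
  qed
  have "bij_betw (\<lambda>A. \<lambda>i\<in>{..<n}. row A i) ?M (PiE {..<n} ?R)"
  proof (rule bij_betwI[where g = ?g])
    show "(\<lambda>A. \<lambda>i\<in>{..<n}. row A i) \<in> ?M \<rightarrow> PiE {..<n} ?R"
    proof (intro funcsetI PiE_I)
      fix A i assume "A \<in> ?M" "i \<in> {..<n}"
      then show "(\<lambda>i\<in>{..<n}. row A i) i \<in> ?R i" using iff by auto
    qed auto
    show "?g \<in> PiE {..<n} ?R \<rightarrow> ?M"
    proof (intro funcsetI CollectI conjI)
      fix f assume f: "f \<in> PiE {..<n} ?R"
      have "row (?g f) i = f i" if "i < n" for i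
        using f that by (intro eq_vecI) (auto dest!: PiE_mem[of f])
      then show "map (\<lambda>v. ?g f *\<^sub>v v) vs = ws"
        using f by (subst iff) (auto dest!: PiE_mem[of f])
    qed auto
    show "?g (\<lambda>i\<in>{..<n}. row A i) = A" if "A \<in> ?M" for A
      using that by (intro eq_matI) auto
    show "(\<lambda>i\<in>{..<n}. row (?g f) i) = f" if f: "f \<in> PiE {..<n} ?R" for f
    proof
      fix i
      show "(\<lambda>i\<in>{..<n}. row (?g f) i) i = f i"
      proof (cases "i < n")
        case True
        then have "row (?g f) i = f i" using f by (intro eq_vecI) (auto dest!: PiE_mem[of f])
        then show ?thesis using True by simp
      next
        case False
        then show ?thesis using PiE_arb[OF f] by simp
      qed
    qed
  qed
  then have "card ?M = (\<Prod>i<n. card (?R i))"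
    by (simp add: bij_betw_same_card card_PiE)
  then have "card ?M * (CARD('k) ^ length vs) ^ n = (\<Prod>i<n. card (?R i) * CARD('k) ^ length vs)"
    by (simp add: prod.distrib)
  also have "\<dots> = (\<Prod>i<n. CARD('k) ^ n)"
    by (intro prod.cong refl card_scalar_prod_fibre[OF vs]) (simp add: ws)
  also have "\<dots> = CARD('k) ^ (n * n)" by (simp add: power_mult)
  finally show ?thesis by (simp add: mult.commute flip: power_mult)
qed

definition eigenspace :: "nat \<Rightarrow> 'k::field mat \<Rightarrow> 'k \<Rightarrow> 'k vec set" where
  "eigenspace n A mu = {v \<in> carrier_vec n. A *\<^sub>v v = mu \<cdot>\<^sub>v v}"

definition eigenlists :: "nat \<Rightarrow> 'k::field mat \<Rightarrow> 'k list \<Rightarrow> 'k vec list set" where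
  "eigenlists n A mus = {vs. indep n vs \<and> list_all2 (\<lambda>mu v. A *\<^sub>v v = mu \<cdot>\<^sub>v v) mus vs}"

lemma finite_eigenspace [simp]: "finite (eigenspace n (A :: 'k::{field,finite} mat) mu)"
  by (rule finite_subset[of _ "carrier_vec n"]) (auto simp: eigenspace_def)

lemma finite_vec_lists: "finite {vs :: 'k::finite vec list. set vs \<subseteq> carrier_vec n \<and> length vs = e}"
  by (rule finite_lists_length_eq) simp

lemma finite_eigenlists [simp]: "finite (eigenlists n (A :: 'k::{field,finite} mat) mus)"
  by (rule finite_subset[OF _ finite_vec_lists[of n "length mus"]])
    (auto simp: eigenlists_def indep_def list_all2_lengthD)

text \<open>By independence a combination of eigenvectors lies in the eigenspace at \<open>mu\<close> iff its coefficients
  at all other eigenvalues vanish.\<close>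
lemma eigenspace_span_card:
  fixes vs :: "'k::{field,finite} vec list"
  assumes A: "A \<in> carrier_mat n n" and vs: "vs \<in> eigenlists n A mus"
  shows "card (eigenspace n A mu \<inter> span_list n vs) = CARD('k) ^ count_list mus mu"
proof -
  let ?S = "\<lambda>mus. {as. list_all2 (\<lambda>a m. m \<noteq> mu \<longrightarrow> a = 0) as mus} :: 'k list set"
  have ind: "indep n vs" and ev: "list_all2 (\<lambda>mu v. A *\<^sub>v v = mu \<cdot>\<^sub>v v) mus vs"
    using vs by (auto simp: eigenlists_def)
  have l: "length mus = length vs" using ev by (rule list_all2_lengthD)
  have vsC: "set vs \<subseteq> carrier_vec n" by (rule indep_carrier[OF ind])
  have "lin_comb n as vs \<in> eigenspace n A mu \<longleftrightarrow> as \<in> ?S mus" if las: "length as = length vs" for as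
  proof -
    have "lin_comb n as vs \<in> eigenspace n A mu \<longleftrightarrow> lin_comb n (map2 (*) as mus) vs = lin_comb n (map ((*) mu) as) vs"
      using A vsC by (simp add: eigenspace_def mult_mat_lin_comb lin_comb_eigen[OF las l ev] lin_comb_smult)
    also have "\<dots> \<longleftrightarrow> map2 (*) as mus = map ((*) mu) as"
      using inj_on_eq_iff[OF indep_inj[OF ind]] las l by simp
    also have "\<dots> \<longleftrightarrow> as \<in> ?S mus"
      using las l by (auto simp: list_eq_iff_nth_eq list_all2_conv_all_nth)
    finally show ?thesis .
  qed
  moreover have "as \<in> ?S mus \<Longrightarrow> length as = length vs" for as
    using l by (auto dest: list_all2_lengthD)
  ultimately have "eigenspace n A mu \<inter> span_list n vs = (\<lambda>as. lin_comb n as vs) ` ?S mus"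
    unfolding span_list_def by blast
  moreover have "inj_on (\<lambda>as. lin_comb n as vs) (?S mus)"
    by (rule inj_on_subset[OF indep_inj[OF ind]]) (use l in \<open>auto dest!: list_all2_lengthD\<close>)
  moreover have "card (?S mus) = CARD('k) ^ count_list mus mu"
  proof (induction mus)
    case Nil
    show ?case by simp
  next
    case (Cons m mus)
    have "?S (m # mus) = (\<lambda>(a, as). a # as) ` ((if m = mu then UNIV else {0}) \<times> ?S mus)"
      by (auto simp: list_all2_Cons2 image_iff)
    moreover have "inj_on (\<lambda>(a, as). a # as) ((if m = mu then UNIV else {0}) \<times> ?S mus)"
      by (auto simp: inj_on_def)
    ultimately have "card (?S (m # mus)) = card ((if m = mu then UNIV else {0 :: 'k}) \<times> ?S mus)"
      by (simp only: card_image)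
    then show ?case using Cons by (simp add: card_cartesian_product)
  qed
  ultimately show ?thesis by (simp add: card_image)
qed

lemma card_Cons_Sigma:
  assumes "finite W" "\<And>vs. vs \<in> W \<Longrightarrow> finite (B vs)"
  shows "card {v # vs | v vs. vs \<in> W \<and> v \<in> B vs} = (\<Sum>vs\<in>W. card (B vs))"
proof -
  have "{v # vs | v vs. vs \<in> W \<and> v \<in> B vs} = (\<lambda>(vs, v). v # vs) ` (SIGMA vs:W. B vs)" by auto
  moreover have "inj_on (\<lambda>(vs, v). v # vs) (SIGMA vs:W. B vs)" by (auto simp: inj_on_def)
  ultimately show ?thesis using assms by (simp add: card_image)
qed

text \<open>A list is extended by an eigenvector that avoids the span of the list; \<open>eigenspace_span_card\<close>
  says how much of the eigenspace is lost.\<close>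
lemma card_eigenlists_Cons:
  fixes A :: "'k::{field,finite} mat"
  assumes A: "A \<in> carrier_mat n n"
  shows "real (card (eigenlists n A (mu # mus)))
    = real (card (eigenlists n A mus)) * (real (card (eigenspace n A mu)) - real CARD('k) ^ count_list mus mu)"
proof -
  let ?B = "\<lambda>vs. eigenspace n A mu - span_list n vs"
  have "eigenlists n A (mu # mus) = {v # vs | v vs. vs \<in> eigenlists n A mus \<and> v \<in> ?B vs}"
    by (auto simp: eigenlists_def list_all2_Cons1 indep_Cons eigenspace_def)
  then have "card (eigenlists n A (mu # mus)) = (\<Sum>vs\<in>eigenlists n A mus. card (?B vs))"
    using card_Cons_Sigma[of "eigenlists n A mus" ?B] by simp
  moreover have "real (card (?B vs)) = real (card (eigenspace n A mu)) - real CARD('k) ^ count_list mus mu"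
    if "vs \<in> eigenlists n A mus" for vs
  proof -
    have "card (?B vs) = card (eigenspace n A mu) - card (eigenspace n A mu \<inter> span_list n vs)"
      by (simp add: card_Diff_subset_Int)
    moreover have "card (eigenspace n A mu \<inter> span_list n vs) \<le> card (eigenspace n A mu)"
      by (intro card_mono) auto
    ultimately show ?thesis by (simp add: eigenspace_span_card[OF A that] of_nat_diff)
  qed
  ultimately show ?thesis by simp
qed

lemma card_indep_lists:
  "real (card {vs :: 'k::{field,finite} vec list. indep n vs \<and> length vs = e})
    = (\<Prod>i<e. real CARD('k) ^ n - real CARD('k) ^ i)"
proof (induction e)
  case 0
  have "{vs :: 'k vec list. indep n vs \<and> length vs = 0} = {[]}" by auto
  then show ?case by simp
next
  case (Suc e)
  let ?W = "{vs :: 'k vec list. indep n vs \<and> length vs = e}"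
  have fin: "finite ?W"
    by (rule finite_subset[OF _ finite_vec_lists[of n e]]) (auto simp: indep_def)
  have "{vs :: 'k vec list. indep n vs \<and> length vs = Suc e}
      = {v # vs | v vs. vs \<in> ?W \<and> v \<in> carrier_vec n - span_list n vs}"
    by (auto simp: length_Suc_conv indep_Cons)
  then have "card {vs :: 'k vec list. indep n vs \<and> length vs = Suc e}
      = (\<Sum>vs\<in>?W. card (carrier_vec n - span_list n vs))"
    using fin card_Cons_Sigma[of ?W "\<lambda>vs. carrier_vec n - span_list n vs"] by simp
  moreover have "real (card (carrier_vec n - span_list n vs)) = real CARD('k) ^ n - real CARD('k) ^ e"
    if "vs \<in> ?W" for vs
  proof -
    have sub: "span_list n vs \<subseteq> carrier_vec n" using that by (intro span_list_carrier) (auto simp: indep_def)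
    have "card (span_list n vs) \<le> card (carrier_vec n :: 'k vec set)"
      by (intro card_mono sub) simp
    moreover have "card (carrier_vec n - span_list n vs) = card (carrier_vec n :: 'k vec set) - card (span_list n vs)"
      by (intro card_Diff_subset sub finite_subset[OF sub]) simp
    ultimately show ?thesis using that by (simp add: card_span_list card_carrier_vec of_nat_diff)
  qed
  ultimately show ?case using Suc by simp
qed

lemma card_eigenlists_prod:
  fixes A :: "'k::{field,finite} mat"
  assumes A: "A \<in> carrier_mat n n" and T: "finite T" "set mus \<subseteq> T"
  shows "real (card (eigenlists n A mus))
    = (\<Prod>mu\<in>T. newton (real CARD('k)) (count_list mus mu) (real (card (eigenspace n A mu))))"
  using T(2)
proof (induction mus)
  case Nil
  have "eigenlists n A [] = {[]}" by (auto simp: eigenlists_def)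
  then show ?case by simp
next
  case (Cons m mus)
  let ?N = "\<lambda>mus mu. newton (real CARD('k)) (count_list mus mu) (real (card (eigenspace n A mu)))"
  have "(\<Prod>mu\<in>T. ?N (m # mus) mu) = ?N (m # mus) m * (\<Prod>mu\<in>T - {m}. ?N (m # mus) mu)"
    using Cons.prems T by (intro prod.remove) auto
  also have "(\<Prod>mu\<in>T - {m}. ?N (m # mus) mu) = (\<Prod>mu\<in>T - {m}. ?N mus mu)"
    by (intro prod.cong) auto
  also have "?N (m # mus) m = ?N mus m * (real (card (eigenspace n A m)) - real CARD('k) ^ count_list mus m)"
    by (simp add: newton_Suc)
  finally have "(\<Prod>mu\<in>T. ?N (m # mus) mu)
      = (\<Prod>mu\<in>T. ?N mus mu) * (real (card (eigenspace n A m)) - real CARD('k) ^ count_list mus m)"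
    using Cons.prems T by (simp add: prod.remove[of T m "?N mus"])
  then show ?case using Cons by (simp add: card_eigenlists_Cons[OF A])
qed

text \<open>Exchange the order of summation: first choose an independent list, then a matrix that maps it to
  the prescribed multiples.\<close>
lemma sum_card_eigenlists:
  "(\<Sum>A\<in>carrier_mat n n. real (card (eigenlists n (A :: 'k::{field,finite} mat) mus)))
    = real CARD('k) ^ (n * n) * indep_probability CARD('k) n (length mus)"
proof -
  let ?M = "carrier_mat n n :: 'k mat set" and ?e = "length mus" and ?Q = "real CARD('k)"
  let ?W = "{vs :: 'k vec list. indep n vs \<and> length vs = length mus}"
  have fin: "finite ?W"
    by (rule finite_subset[OF _ finite_vec_lists[of n ?e]]) (auto simp: indep_def)
  have Q: "?Q > 0" by simp
  let ?ev = "\<lambda>A vs. map (\<lambda>v. A *\<^sub>v v) vs = map2 (\<lambda>mu v. mu \<cdot>\<^sub>v v) mus vs"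
  have ev: "eigenlists n A mus = {vs \<in> ?W. ?ev A vs}" for A
    by (auto simp: eigenlists_def list_all2_conv_all_nth list_eq_iff_nth_eq)
  have "real (card {A \<in> ?M. ?ev A vs}) = ?Q ^ (n * n) / (?Q ^ n) ^ ?e" if vs: "vs \<in> ?W" for vs
  proof -
    have "set (map2 (\<lambda>mu v. mu \<cdot>\<^sub>v v) mus vs) \<subseteq> carrier_vec n"
      using vs by (auto simp: indep_def dest!: set_zip_rightD)
    then have "card {A \<in> ?M. ?ev A vs} * (CARD('k) ^ n) ^ length vs = CARD('k) ^ (n * n)"
      using vs by (intro card_mat_prescribed) auto
    then have "real (card {A \<in> ?M. ?ev A vs} * (CARD('k) ^ n) ^ ?e) = ?Q ^ (n * n)"
      using vs by simp
    then show ?thesis using Q by (simp add: field_simps)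
  qed
  then have "(\<Sum>A\<in>?M. real (card (eigenlists n A mus))) = (\<Sum>vs\<in>?W. ?Q ^ (n * n) / (?Q ^ n) ^ ?e)"
    unfolding ev of_nat_sum[symmetric]
    by (subst sum_card_swap) (use fin in simp_all)
  also have "\<dots> = ?Q ^ (n * n) * ((\<Prod>i<?e. ?Q ^ n - ?Q ^ i) / (?Q ^ n) ^ ?e)"
    by (simp add: card_indep_lists)
  also have "(\<Prod>i<?e. ?Q ^ n - ?Q ^ i) / (?Q ^ n) ^ ?e = (\<Prod>i<?e. (?Q ^ n - ?Q ^ i) / ?Q ^ n)"
    by (simp add: prod_dividef)
  also have "\<dots> = indep_probability CARD('k) n ?e"
    unfolding indep_probability_def using Q by (intro prod.cong) (auto simp: diff_divide_distrib)
  finally show ?thesis .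
qed

lemma list_with_counts:
  assumes "finite T"
  shows "\<exists>xs. set xs \<subseteq> T \<and> (\<forall>x\<in>T. count_list xs x = e x) \<and> length xs = sum e T"
  using assms
proof (induction T)
  case empty
  show ?case by simp
next
  case (insert y T)
  then obtain xs where xs: "set xs \<subseteq> T" "\<forall>x\<in>T. count_list xs x = e x" "length xs = sum e T" by blast
  have y: "count_list xs y = 0" using xs(1) insert.hyps by (auto simp: count_list_0_iff)
  have rep: "count_list (replicate k z) x = (if x = z then k else 0)" for k and z x :: 'a
    by (induction k) auto
  have "set (replicate (e y) y @ xs) \<subseteq> insert y T" using xs by auto
  moreover have "\<forall>x\<in>insert y T. count_list (replicate (e y) y @ xs) x = e x"
    using xs y insert.hyps by (auto simp: rep)
  moreover have "length (replicate (e y) y @ xs) = sum e (insert y T)"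
    using xs insert.hyps by simp
  ultimately show ?case by blast
qed

text \<open>The dimensions of the eigenspaces enter through the number of lists of eigenvectors in which each
  \<open>mu\<close> occurs \<open>e mu\<close> times; the right-hand side depends on the multiplicities only through their
  sum.\<close>
lemma joint_factorial_moment:
  fixes T :: "'k::{field,finite} set"
  shows "(\<Sum>A\<in>carrier_mat n n. \<Prod>mu\<in>T. newton (real CARD('k)) (e mu) (real (card (eigenspace n A mu))))
    = real CARD('k) ^ (n * n) * indep_probability CARD('k) n (sum e T)"
proof -
  obtain mus where mus: "set mus \<subseteq> T" "\<forall>x\<in>T. count_list mus x = e x" "length mus = sum e T"
    using list_with_counts[of T e] by auto
  have "(\<Sum>A\<in>carrier_mat n n. \<Prod>mu\<in>T. newton (real CARD('k)) (e mu) (real (card (eigenspace n A mu))))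
      = (\<Sum>A\<in>carrier_mat n n. real (card (eigenlists n (A :: 'k mat) mus)))"
    using mus by (intro sum.cong refl) (simp add: card_eigenlists_prod[of _ _ T])
  then show ?thesis by (simp add: sum_card_eigenlists mus)
qed
section \<open>Prescribed eigenspaces: dependence of the density on the matrix size\<close>

text \<open>If the size of the eigenspace were no power \<open>Q ^ d\<close> with \<open>d \<le> n\<close>, the product formula would yield
  independent lists of eigenvectors of length \<open>n + 1\<close>.\<close>
lemma card_eigenspace_power:
  fixes A :: "'k::{field,finite} mat"
  assumes A: "A \<in> carrier_mat n n"
  shows "\<exists>d\<le>n. card (eigenspace n A mu) = CARD('k) ^ d"
proof (rule ccontr)
  assume neg: "\<not> ?thesis"
  let ?x = "real (card (eigenspace n A mu))"
  have cnt: "count_list (replicate k mu) mu = k" for k by (induction k) auto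
  have "?x - real CARD('k) ^ i \<noteq> 0" if "i < Suc n" for i
    using neg that by (metis eq_iff_diff_eq_0 less_Suc_eq_le of_nat_eq_iff of_nat_power)
  then have "newton (real CARD('k)) (Suc n) ?x \<noteq> 0" by (auto simp: newton_def)
  moreover have "real (card (eigenlists n A (replicate (Suc n) mu))) = newton (real CARD('k)) (Suc n) ?x"
    using card_eigenlists_prod[OF A, of "{mu}" "replicate (Suc n) mu"] cnt[of "Suc n"]
    by (simp add: set_replicate_conv_if del: replicate_Suc)
  ultimately have "card (eigenlists n A (replicate (Suc n) mu)) \<noteq> 0"
    by (metis of_nat_0)
  then obtain vs where vs: "vs \<in> eigenlists n A (replicate (Suc n) mu)"
    by (metis card.empty equals0I)
  then have ind: "indep n vs" "length vs = Suc n"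
    by (auto simp: eigenlists_def dest!: list_all2_lengthD)
  have "card (span_list n vs) \<le> card (carrier_vec n :: 'k vec set)"
    using ind by (intro card_mono span_list_carrier indep_carrier) auto
  then show False
    using card_field_gt_1[where 'k = 'k] ind by (simp add: card_span_list card_carrier_vec)
qed

text \<open>Sizes replace dimensions: on the set \<open>S\<close> there is a single eigenvalue, and its eigenspace is a
  line.\<close>
definition one_eigenline :: "nat \<Rightarrow> 'k::{field,finite} mat \<Rightarrow> 'k set \<Rightarrow> bool" where
  "one_eigenline n A S \<longleftrightarrow> (\<exists>mu\<in>S. card (eigenspace n A mu) = CARD('k) \<and>
     (\<forall>nu\<in>S - {mu}. card (eigenspace n A nu) = 1))"

definition prescribed :: "nat \<Rightarrow> 'k::{field,finite} set \<Rightarrow> 'k set \<Rightarrow> 'k set set \<Rightarrow> 'k mat set" where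
  "prescribed n T R SS = {A \<in> carrier_mat n n.
     (\<forall>mu\<in>T. card (eigenspace n A mu) = (if mu \<in> R then CARD('k) else 1)) \<and>
     (\<forall>S\<in>SS. \<not> one_eigenline n A S)}"

definition density :: "nat \<Rightarrow> 'k::{field,finite} mat set \<Rightarrow> real" where
  "density n M = real (card M) / real CARD('k) ^ (n * n)"

definition indicator_coeff :: "real \<Rightarrow> bool \<Rightarrow> nat \<Rightarrow> real" where
  "indicator_coeff Q p = (if p then one_coeff Q else zero_coeff Q)"

text \<open>Expand the indicators in Newton polynomials, multiply out, and take the average.  Any \<open>m \<ge> n\<close> is
  allowed as a cutoff, so one set of coefficients serves two matrix sizes at once.\<close>
lemma density_prescribed:
  fixes T R :: "'k::{field,finite} set"
  assumes m: "n \<le> m"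
  shows "density n (prescribed n T R {})
    = (\<Sum>e\<in>PiE T (\<lambda>_. {..m}). (\<Prod>mu\<in>T. indicator_coeff (real CARD('k)) (mu \<in> R) (e mu)) * indep_probability CARD('k) n (sum e T))"
proof -
  let ?Q = "real CARD('k)" and ?M = "carrier_mat n n :: 'k mat set"
  let ?x = "\<lambda>A mu. real (card (eigenspace n (A :: 'k mat) mu))"
  let ?a = "\<lambda>mu. indicator_coeff ?Q (mu \<in> R)"
  have Q: "?Q > 1" using card_field_gt_1[where 'k = 'k] by simp
  have single: "(\<Sum>e\<le>m. ?a mu e * newton ?Q e (?x A mu))
      = of_bool (card (eigenspace n A mu) = (if mu \<in> R then CARD('k) else 1))" if A: "A \<in> ?M" for A mu
  proof -
    obtain d where d: "d \<le> n" "card (eigenspace n A mu) = CARD('k) ^ d"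
      using card_eigenspace_power[OF A] by blast
    have "CARD('k) ^ d = CARD('k) ^ 1 \<longleftrightarrow> d = 1" "CARD('k) ^ d = CARD('k) ^ 0 \<longleftrightarrow> d = 0"
      using Q by (subst power_inject_exp; simp)+
    then show ?thesis
      using d m Q by (auto simp: indicator_coeff_def one_coeff_indicator zero_coeff_indicator)
  qed
  have "real (card (prescribed n T R {}))
      = (\<Sum>A\<in>?M. of_bool (\<forall>mu\<in>T. card (eigenspace n A mu) = (if mu \<in> R then CARD('k) else 1)))"
    by (simp add: prescribed_def sum_of_bool_eq) (intro arg_cong[where f = card]; auto)
  also have "\<dots> = (\<Sum>A\<in>?M. \<Prod>mu\<in>T. \<Sum>e\<le>m. ?a mu e * newton ?Q e (?x A mu))"
  proof (intro sum.cong refl)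
    fix A assume A: "A \<in> ?M"
    have "of_bool (\<forall>mu\<in>T. card (eigenspace n A mu) = (if mu \<in> R then CARD('k) else 1))
        = (\<Prod>mu\<in>T. of_bool (card (eigenspace n A mu) = (if mu \<in> R then CARD('k) else 1)) :: real)"
    proof (cases "\<forall>mu\<in>T. card (eigenspace n A mu) = (if mu \<in> R then CARD('k) else 1)")
      case True
      then show ?thesis by (subst prod.neutral) auto
    next
      case False
      then have "\<exists>mu\<in>T. of_bool (card (eigenspace n A mu) = (if mu \<in> R then CARD('k) else 1)) = (0 :: real)"
        by auto
      then have "(\<Prod>mu\<in>T. of_bool (card (eigenspace n A mu) = (if mu \<in> R then CARD('k) else 1)) :: real) = 0"
        by (intro prod_zero) auto
      then show ?thesis using False by (simp only: of_bool_eq)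
    qed
    then show "of_bool (\<forall>mu\<in>T. card (eigenspace n A mu) = (if mu \<in> R then CARD('k) else 1))
        = (\<Prod>mu\<in>T. \<Sum>e\<le>m. ?a mu e * newton ?Q e (?x A mu))"
      using single[OF A] by (simp only:)
  qed
  also have "\<dots> = (\<Sum>A\<in>?M. \<Sum>e\<in>PiE T (\<lambda>_. {..m}). \<Prod>mu\<in>T. ?a mu (e mu) * newton ?Q (e mu) (?x A mu))"
    by (intro sum.cong refl prod_sum_PiE) auto
  also have "\<dots> = (\<Sum>e\<in>PiE T (\<lambda>_. {..m}). (\<Prod>mu\<in>T. ?a mu (e mu)) * (\<Sum>A\<in>?M. \<Prod>mu\<in>T. newton ?Q (e mu) (?x A mu)))"
    by (subst sum.swap) (simp add: prod.distrib sum_distrib_left)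
  also have "\<dots> = ?Q ^ (n * n) * (\<Sum>e\<in>PiE T (\<lambda>_. {..m}). (\<Prod>mu\<in>T. ?a mu (e mu)) * indep_probability CARD('k) n (sum e T))"
    by (simp add: joint_factorial_moment sum_distrib_left algebra_simps)
  finally show ?thesis by (simp add: density_def)
qed

lemma density_prescribed_diff:
  fixes T R :: "'k::{field,finite} set"
  assumes Q4: "CARD('k) \<ge> 4" and n: "n \<le> n'"
  shows "\<bar>density n (prescribed n T R {}) - density n' (prescribed n' T R {})\<bar>
    \<le> (16 / 3) ^ card T / real CARD('k) ^ n"
proof -
  let ?Q = "real CARD('k)" and ?E = "PiE T (\<lambda>_. {..n'})"
  let ?a = "\<lambda>mu. indicator_coeff ?Q (mu \<in> R)"
  have "\<bar>density n (prescribed n T R {}) - density n' (prescribed n' T R {})\<bar>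
      = \<bar>\<Sum>e\<in>?E. (\<Prod>mu\<in>T. ?a mu (e mu)) * (indep_probability CARD('k) n (sum e T) - indep_probability CARD('k) n' (sum e T))\<bar>"
    unfolding density_prescribed[OF n] density_prescribed[OF order_refl[of n']]
    by (simp add: right_diff_distrib flip: sum_subtractf)
  also have "\<dots> \<le> (\<Sum>e\<in>?E. (\<Prod>mu\<in>T. \<bar>?a mu (e mu)\<bar>) * (?Q ^ sum e T / ?Q ^ n))"
    unfolding abs_prod[symmetric]
    by (intro order.trans[OF sum_abs] sum_mono, unfold abs_mult, intro mult_left_mono indep_probability_diff_le)
      (use Q4 n in auto)
  also have "\<dots> = (\<Sum>e\<in>?E. \<Prod>mu\<in>T. \<bar>?a mu (e mu)\<bar> * ?Q ^ e mu) / ?Q ^ n"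
    by (simp add: sum_divide_distrib prod.distrib power_sum)
  also have "(\<Sum>e\<in>?E. \<Prod>mu\<in>T. \<bar>?a mu (e mu)\<bar> * ?Q ^ e mu) = (\<Prod>mu\<in>T. \<Sum>e\<le>n'. \<bar>?a mu e\<bar> * ?Q ^ e)"
    by (rule prod_sum_PiE[symmetric]) auto
  also have "\<dots> / ?Q ^ n \<le> (\<Prod>mu\<in>T. 16 / 3) / ?Q ^ n"
  proof (intro divide_right_mono prod_mono conjI sum_abs_coeff_le)
    fix mu e
    show "\<bar>?a mu e\<bar> * ?Q ^ e \<le> 8 / 3 * (1 / 2) ^ e"
      using Q4 one_coeff_abs_le[of ?Q e] zero_coeff_abs_le[of ?Q e]
      by (cases "mu \<in> R") (simp_all add: indicator_coeff_def)
  qed (auto intro!: sum_nonneg)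
  finally show ?thesis by simp
qed

lemma finite_prescribed [simp]: "finite (prescribed n T R SS)"
  by (rule finite_subset[of _ "carrier_mat n n"]) (auto simp: prescribed_def)

text \<open>The matrices with a single eigenline on \<open>S\<close> split according to the eigenvalue \<open>mu\<close> of that line,
  and each part again prescribes eigenspaces, now on \<open>T \<union> S\<close>.\<close>
lemma prescribed_insert:
  fixes T R S :: "'k::{field,finite} set"
  assumes S: "finite S" "S \<inter> T = {}" and R: "R \<subseteq> T"
  shows "density n (prescribed n T R (insert S SS))
    = density n (prescribed n T R SS) - (\<Sum>mu\<in>S. density n (prescribed n (T \<union> S) (insert mu R) SS))"
proof -
  let ?P = "\<lambda>mu. prescribed n (T \<union> S) (insert mu R) SS"
  have Q: "CARD('k) \<noteq> 1" using card_field_gt_1[where 'k = 'k] by simp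
  have sub: "(\<Union>mu\<in>S. ?P mu) = {A \<in> prescribed n T R SS. one_eigenline n A S}"
  proof (intro equalityI subsetI)
    fix A assume "A \<in> (\<Union>mu\<in>S. ?P mu)"
    then obtain mu where mu: "mu \<in> S" and A: "A \<in> ?P mu" by auto
    have "card (eigenspace n A nu) = (if nu \<in> R then CARD('k) else 1)" if "nu \<in> T" for nu
      using A that mu S by (auto simp: prescribed_def)
    moreover have "one_eigenline n A S"
      unfolding one_eigenline_def
      using A mu S R by (intro bexI[of _ mu]) (auto simp: prescribed_def)
    ultimately show "A \<in> {A \<in> prescribed n T R SS. one_eigenline n A S}"
      using A by (auto simp: prescribed_def)
  next
    fix A assume A: "A \<in> {A \<in> prescribed n T R SS. one_eigenline n A S}"
    then obtain mu where mu: "mu \<in> S" "card (eigenspace n A mu) = CARD('k)"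
      "\<forall>nu\<in>S - {mu}. card (eigenspace n A nu) = 1"
      by (auto simp: one_eigenline_def)
    have "card (eigenspace n A nu) = (if nu \<in> insert mu R then CARD('k) else 1)" if "nu \<in> T \<union> S" for nu
      using that mu S R A by (cases "nu = mu") (auto simp: prescribed_def)
    then show "A \<in> (\<Union>mu\<in>S. ?P mu)"
      using A mu(1) by (auto simp: prescribed_def)
  qed
  have "?P mu \<inter> ?P nu = {}" if "mu \<in> S" "nu \<in> S" "mu \<noteq> nu" for mu nu
  proof (rule ccontr)
    assume "?P mu \<inter> ?P nu \<noteq> {}"
    then obtain A where A: "A \<in> ?P mu" "A \<in> ?P nu" by auto
    have "card (eigenspace n A mu) = CARD('k)" using A(1) that by (auto simp: prescribed_def)
    moreover have "card (eigenspace n A mu) = 1"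
    proof -
      have "mu \<notin> insert nu R" using that S R by auto
      then show ?thesis using A(2) that unfolding prescribed_def by auto
    qed
    ultimately show False using Q by simp
  qed
  then have "card (\<Union>mu\<in>S. ?P mu) = (\<Sum>mu\<in>S. card (?P mu))"
    using S(1) by (intro card_UN_disjoint) auto
  moreover have "prescribed n T R (insert S SS) = prescribed n T R SS - (\<Union>mu\<in>S. ?P mu)"
    unfolding sub by (auto simp: prescribed_def)
  moreover have "(\<Union>mu\<in>S. ?P mu) \<subseteq> prescribed n T R SS" unfolding sub by auto
  ultimately have "real (card (prescribed n T R (insert S SS)))
      = real (card (prescribed n T R SS)) - (\<Sum>mu\<in>S. real (card (?P mu)))"
    by (metis card_Diff_subset card_mono finite_prescribed finite_subset of_nat_diff of_nat_sum)
  then show ?thesis by (simp add: density_def diff_divide_distrib sum_divide_distrib)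
qed

text \<open>Removing a set \<open>S\<close> adds \<open>b\<close> terms in which \<open>b\<close> more eigenspaces are prescribed, each costing a
  factor \<open>16/3\<close>; this is the factor \<open>1 + b * (16/3) ^ b\<close>.\<close>
lemma density_prescribed_family_diff:
  fixes T R :: "'k::{field,finite} set"
  assumes Q4: "CARD('k) \<ge> 4" and n: "n \<le> n'" and fin: "finite SS"
  assumes "disjoint SS" "\<And>S. S \<in> SS \<Longrightarrow> card S = b" "T \<inter> \<Union>SS = {}" "R \<subseteq> T"
  shows "\<bar>density n (prescribed n T R SS) - density n' (prescribed n' T R SS)\<bar>
    \<le> (16 / 3) ^ card T * (1 + real b * (16 / 3) ^ b) ^ card SS / real CARD('k) ^ n"
  using fin assms(4-)
proof (induction SS arbitrary: T R)
  case empty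
  then show ?case using density_prescribed_diff[OF Q4 n] by simp
next
  case (insert S SS)
  let ?D = "\<lambda>T R. \<bar>density n (prescribed n T R SS) - density n' (prescribed n' T R SS)\<bar>"
  let ?B = "1 + real b * (16 / 3) ^ b"
  let ?c = "(16 / 3) ^ card T * ?B ^ card SS / real CARD('k) ^ n"
  have disj: "disjoint SS" "S \<inter> \<Union>SS = {}" "S \<inter> T = {}"
    using insert.prems insert.hyps by (auto simp: disjoint_def)
  have cS: "card S = b" using insert.prems by simp
  have "\<bar>density n (prescribed n T R (insert S SS)) - density n' (prescribed n' T R (insert S SS))\<bar>
      \<le> ?D T R + \<bar>\<Sum>mu\<in>S. density n (prescribed n (T \<union> S) (insert mu R) SS)
          - density n' (prescribed n' (T \<union> S) (insert mu R) SS)\<bar>"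
    using insert.prems disj by (simp add: prescribed_insert sum_subtractf)
  also have "\<dots> \<le> ?D T R + (\<Sum>mu\<in>S. ?D (T \<union> S) (insert mu R))"
    by (intro add_left_mono sum_abs)
  also have "\<dots> \<le> ?c + (\<Sum>mu\<in>S. (16 / 3) ^ card (T \<union> S) * ?B ^ card SS / real CARD('k) ^ n)"
    using insert.prems disj by (intro add_mono sum_mono insert.IH) auto
  also have "card (T \<union> S) = card T + b"
    using disj cS by (simp add: card_Un_disjoint Int_commute)
  also have "?c + (\<Sum>mu\<in>S. (16 / 3) ^ (card T + b) * ?B ^ card SS / real CARD('k) ^ n) = ?c * ?B"
    by (simp add: cS power_add algebra_simps add_divide_distrib)
  also have "\<dots> = (16 / 3) ^ card T * ?B ^ card (insert S SS) / real CARD('k) ^ n"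
    using insert.hyps by simp
  finally show ?case .
qed

section \<open>Matrices cyclic at a prime of full degree\<close>

lemma poly_endo_restrict_scalars:
  assumes "field_hom h"
  shows "poly_endo (restrict_scalars h V) f Y v = poly_endo V (map_poly h f) Y v"
proof -
  interpret h: field_hom h by (rule assms)
  show ?thesis
    by (simp add: poly_endo_def finsum_def finprod_def restrict_scalars_def)
qed

lemma finite_lin_endo_row_action:
  fixes X :: "'k::{field,finite} mat"
  assumes "X \<in> carrier_mat c c"
  shows "finite_lin_endo (module_vec TYPE('k) c) (row_action X)"
  unfolding finite_lin_endo_def lin_endo_def lin_endo_axioms_def finite_lin_endo_axioms_def
  using assms
  by (auto simp: vec_vs module_hom_def module_vec_simps row_action_def
      mult_add_distrib_mat_vec[of _ c c] mult_mat_vec[of _ c c])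

lemma finite_lin_endo_restrict_scalars:
  fixes h :: "'f::{field,finite} \<Rightarrow> 'k::{field,finite}"
  assumes "field_hom h" "X \<in> carrier_mat c c"
  shows "finite_lin_endo (restrict_scalars h (module_vec TYPE('k) c)) (row_action X)"
  unfolding finite_lin_endo_def lin_endo_def lin_endo_axioms_def finite_lin_endo_axioms_def
  using assms by (simp add: vectorspace_restrict_scalars row_action_hom)
    (simp add: restrict_scalars_def module_vec_simps)

definition root_sets :: "('f::field \<Rightarrow> 'k::field) \<Rightarrow> nat \<Rightarrow> 'k set set" where
  "root_sets h b = (\<lambda>f. {a. poly (map_poly h f) a = 0}) ` {f. monic f \<and> irreducible f \<and> degree f = b}"

context
  fixes h :: "'f::{field,finite} \<Rightarrow> 'k::{field,finite}" and b :: nat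
  assumes h: "field_hom h" and b: "b > 0" and card_ext: "CARD('k) = CARD('f) ^ b"
begin

lemma splits_in_extension:
  assumes f: "monic f" "irreducible f" "degree f = b"
  shows "card {a. poly (map_poly h f) a = 0} = b"
    "map_poly h f = (\<Prod>a | poly (map_poly h f) a = 0. [:- a, 1:])"
proof -
  interpret h: field_hom h by (rule h)
  have "f dvd [:0, 1:] ^ CARD('k) - [:0, 1:]"
    using irreducible_dvd_frobenius[OF f(2)] f(3) b card_ext by simp
  then have "map_poly h f dvd [:0, 1:] ^ CARD('k) - [:0, 1:]" by (rule field_hom_power_dvd[OF h])
  moreover have "monic (map_poly h f)" "degree (map_poly h f) = b" using f by simp_all
  ultimately show "card {a. poly (map_poly h f) a = 0} = b"
    "map_poly h f = (\<Prod>a | poly (map_poly h f) a = 0. [:- a, 1:])"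
    using split_of_dvd_frobenius[of "map_poly h f"] by auto
qed

lemma card_root_set: "S \<in> root_sets h b \<Longrightarrow> card S = b"
  using splits_in_extension(1) by (auto simp: root_sets_def)

lemma disjoint_root_sets: "disjoint (root_sets h b)"
  unfolding disjoint_def root_sets_def using irreducible_common_root[OF h] by blast

lemma card_root_sets: "card (root_sets h b) * b \<le> CARD('k)"
proof -
  have "card (\<Union>(root_sets h b)) = (\<Sum>S\<in>root_sets h b. card S)"
    using disjoint_root_sets by (intro card_Union_disjoint) (auto simp: disjoint_def pairwise_def disjnt_def)
  also have "\<dots> = card (root_sets h b) * b" by (simp add: card_root_set)
  finally show ?thesis by (metis card_mono finite subset_UNIV)
qed

text \<open>The product is \<open>Q\<close> raised to the sum of the dimensions, and a sum of natural numbers is 1 iff one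
  of them is 1 and the others vanish.\<close>
lemma one_eigenline_iff_prod:
  fixes A :: "'k mat"
  assumes A: "A \<in> carrier_mat c c"
  shows "one_eigenline c A S \<longleftrightarrow> (\<Prod>a\<in>S. card (eigenspace c A a)) = CARD('k)"
proof -
  obtain d where d: "\<And>a. card (eigenspace c A a) = CARD('k) ^ d a"
    using card_eigenspace_power[OF A] by metis
  have Q: "CARD('k) > 1" using card_field_gt_1[where 'k = 'k] by simp
  have pw: "CARD('k) ^ n = CARD('k) \<longleftrightarrow> n = 1" "CARD('k) ^ n = 1 \<longleftrightarrow> n = 0" for n
    using power_inject_exp[OF Q, of n 1] power_inject_exp[OF Q, of n 0] by simp_all
  have "(\<Prod>a\<in>S. card (eigenspace c A a)) = CARD('k) ^ (\<Sum>a\<in>S. d a)" by (simp add: d power_sum)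
  then have "(\<Prod>a\<in>S. card (eigenspace c A a)) = CARD('k) \<longleftrightarrow> (\<Sum>a\<in>S. d a) = 1" by (simp only: pw)
  also have "\<dots> \<longleftrightarrow> (\<exists>mu\<in>S. d mu = 1 \<and> (\<forall>nu\<in>S - {mu}. d nu = 0))"
    unfolding sum_eq_1_iff[OF finite[of S]] by (intro bex_cong conj_cong refl) auto
  finally show ?thesis unfolding one_eigenline_def by (simp only: d pw)
qed

text \<open>The kernel of \<open>f\<close> is the same over both fields.  Over the large one \<open>f\<close> is a product of
  distinct linear factors, so the size of its kernel is the product of the sizes of the eigenspaces.
  The transpose turns row vectors multiplied by \<open>X\<close> into column vectors.\<close>
lemma pcb_iff:
  assumes X: "X \<in> carrier_mat c c"
  shows "X \<in> pcb h b c \<longleftrightarrow> (\<exists>S\<in>root_sets h b. one_eigenline c (transpose_mat X) S)"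
proof -
  let ?VF = "restrict_scalars h (module_vec TYPE('k) c)" and ?V = "module_vec TYPE('k) c"
  interpret F: finite_lin_endo ?VF "row_action X" by (rule finite_lin_endo_restrict_scalars[OF h X])
  interpret K: finite_lin_endo ?V "row_action X" by (rule finite_lin_endo_row_action[OF X])
  have "primary_cyclic ?VF f (row_action X)
      \<longleftrightarrow> one_eigenline c (transpose_mat X) {a. poly (map_poly h f) a = 0}"
    if f: "monic f" "irreducible f" "degree f = b" for f
  proof -
    let ?S = "{a. poly (map_poly h f) a = 0}"
    have "F.ker f = K.ker (map_poly h f)"
      by (simp add: poly_endo_restrict_scalars[OF h]) (simp add: restrict_scalars_def module_vec_simps)
    also have "card \<dots> = (\<Prod>a\<in>?S. card {v \<in> carrier ?V. row_action X v = a \<odot>\<^bsub>?V\<^esub> v})"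
      by (subst splits_in_extension(2)[OF f], rule K.card_ker_prod_linear) simp
    also have "\<dots> = (\<Prod>a\<in>?S. card (eigenspace c (transpose_mat X) a))"
      by (simp add: eigenspace_def row_action_def module_vec_simps)
    finally have "card (F.ker f) = (\<Prod>a\<in>?S. card (eigenspace c (transpose_mat X) a))" .
    then show ?thesis
      using F.primary_cyclic_iff_card_ker[OF f(2)] f(3) b card_ext X one_eigenline_iff_prod[of "transpose_mat X" c ?S]
      by simp
  qed
  then show ?thesis using X by (auto simp: pcb_def root_sets_def)
qed

lemma pcb_proportion_eq:
  "pcb_proportion h b c = 1 - density c (prescribed c {} {} (root_sets h b))"
proof -
  let ?M = "carrier_mat c c :: 'k mat set" and ?P = "prescribed c {} {} (root_sets h b)"
  have "bij_betw transpose_mat (pcb h b c) (?M - ?P)"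
  proof (rule bij_betwI[where g = transpose_mat])
    have sub: "pcb h b c \<subseteq> ?M" by (auto simp: pcb_def)
    show "transpose_mat \<in> pcb h b c \<rightarrow> ?M - ?P"
    proof
      fix X assume "X \<in> pcb h b c"
      then show "transpose_mat X \<in> ?M - ?P" using sub pcb_iff[of X c] by (auto simp: prescribed_def)
    qed
    show "transpose_mat \<in> ?M - ?P \<rightarrow> pcb h b c"
    proof
      fix A assume "A \<in> ?M - ?P"
      then show "transpose_mat A \<in> pcb h b c" using pcb_iff[of "transpose_mat A" c] by (auto simp: prescribed_def)
    qed
  qed simp_all
  then have "card (pcb h b c) = card (?M - ?P)" by (rule bij_betw_same_card)
  moreover have "?P \<subseteq> ?M" by (auto simp: prescribed_def)
  ultimately have "real (card (pcb h b c)) = real (card ?M) - real (card ?P)"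
    by (simp add: card_Diff_subset card_mono of_nat_diff)
  then show ?thesis
    by (simp add: pcb_proportion_def density_def card_carrier_mat diff_divide_distrib)
qed

end

section \<open>Convergence and the error bound\<close>

text \<open>The error bound passes to the limit in the second index.\<close>
lemma convergent_of_geometric_cauchy:
  fixes x :: "nat \<Rightarrow> real"
  assumes Q: "Q > 1" and bound: "\<And>c c'. c \<le> c' \<Longrightarrow> \<bar>x c - x c'\<bar> \<le> B / Q ^ c"
  shows "convergent x" "\<bar>x c - lim x\<bar> \<le> B / Q ^ c"
proof -
  have "(\<lambda>c. B * (1 / Q) ^ c) \<longlonglongrightarrow> B * 0"
    using Q by (intro tendsto_mult tendsto_const LIMSEQ_realpow_zero) auto
  then have lim0: "(\<lambda>c. B / Q ^ c) \<longlonglongrightarrow> 0" by (simp add: power_one_over)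
  have "Cauchy x"
  proof (rule metric_CauchyI)
    fix e :: real assume "e > 0"
    then have "\<forall>\<^sub>F c in sequentially. B / Q ^ c < e" using lim0 by (rule order_tendstoD(2)[rotated])
    then obtain N where N: "\<And>c. c \<ge> N \<Longrightarrow> B / Q ^ c < e" by (auto simp: eventually_sequentially)
    have "dist (x m) (x n) < e" if "N \<le> m" "N \<le> n" for m n
      using bound[of m n] bound[of n m] N[of m] N[of n] that
      by (cases "m \<le> n") (auto simp: dist_real_def abs_minus_commute)
    then show "\<exists>M. \<forall>m\<ge>M. \<forall>n\<ge>M. dist (x m) (x n) < e" by blast
  qed
  then show conv: "convergent x" by (rule Cauchy_convergent)
  then have "x \<longlonglongrightarrow> lim x" by (simp add: convergent_LIMSEQ_iff)
  then have "(\<lambda>c'. \<bar>x c - x c'\<bar>) \<longlonglongrightarrow> \<bar>x c - lim x\<bar>" by (intro tendsto_intros)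
  then show "\<bar>x c - lim x\<bar> \<le> B / Q ^ c"
    by (rule tendsto_upperbound) (auto simp: eventually_sequentially intro!: exI[of _ c] bound)
qed

text \<open>The base of the power in \<open>a_J\<close> is at least \<open>b * 16 ^ b\<close>, because \<open>q ^ b \<ge> 4\<close>, hence at
  least \<open>1 + b * (16/3) ^ b\<close>; and the exponent there is at least \<open>N\<close>.\<close>
lemma error_constant_le_a_J:
  fixes q b N :: nat
  assumes q: "q \<ge> 2" and b: "b \<ge> 2" and N: "N * b \<le> q ^ b"
  shows "(1 + real b * (16 / 3) ^ b) ^ N \<le> a_J q b"
proof -
  define Q where "Q = real q ^ b"
  let ?base = "real b * Q / (Q - 1) * 2 ^ b * (2 * Q) ^ b * real q ^ (b\<^sup>2)"
  have "(2::real) ^ 2 \<le> real q ^ 2" using q by (intro power_mono) auto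
  also have "\<dots> \<le> Q" unfolding Q_def using q b by (intro power_increasing) auto
  finally have Q4: "Q \<ge> 4" by simp
  have "1 + real b * (16 / 3) ^ b \<le> real b * 16 ^ b"
  proof -
    have "(3::real) ^ 1 \<le> 3 ^ b" using b by (intro power_increasing) auto
    then have "3 * (16 / 3 :: real) ^ b \<le> 3 ^ b * (16 / 3) ^ b" by (intro mult_right_mono) auto
    also have "\<dots> = 16 ^ b" unfolding power_mult_distrib[symmetric] by simp
    finally have "real b * (3 * (16 / 3) ^ b) \<le> real b * 16 ^ b" by (intro mult_left_mono) auto
    moreover have "1 * 1 \<le> real b * (16 / 3) ^ b" using b by (intro mult_mono) auto
    ultimately show ?thesis by simp
  qed
  also have "\<dots> \<le> ?base"
  proof -
    have "real b * 16 ^ b * 1 \<le> real b * Q / (Q - 1) * (4 * Q) ^ b * real q ^ (b\<^sup>2)"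
    proof (intro mult_mono)
      show "real b \<le> real b * Q / (Q - 1)" using Q4 by (simp add: field_simps)
      show "(16::real) ^ b \<le> (4 * Q) ^ b" using Q4 by (intro power_mono) auto
      show "1 \<le> real q ^ b\<^sup>2" using q by (intro one_le_power) auto
    qed (use Q4 in auto)
    also have "(4 * Q) ^ b = 2 ^ b * (2 * Q) ^ b"
      unfolding power_mult_distrib[symmetric] by simp
    finally show ?thesis by (simp only: mult.assoc mult_1_right)
  qed
  finally have base: "1 + real b * (16 / 3) ^ b \<le> ?base" .
  have base1: "?base \<ge> 1" using base by (rule order.trans[rotated]) simp
  have "(1 + real b * (16 / 3) ^ b) ^ N \<le> ?base ^ N" using base by (intro power_mono) auto
  also have "\<dots> = ?base powr real N" using base1 by (subst powr_realpow) auto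
  also have "\<dots> \<le> ?base powr (Q / real b)"
  proof (intro powr_mono base1)
    have "real (N * b) \<le> real (q ^ b)" using N by (simp only: of_nat_le_iff)
    then show "real N \<le> Q / real b" using b by (simp add: Q_def field_simps)
  qed
  also have "\<dots> \<le> 8 / 3 * ?base powr (Q / real b)" by simp
  also have "\<dots> = a_J q b" by (simp add: a_J_def Q_def)
  finally show ?thesis .
qed

theorem proposition5p10:
  fixes h :: "'f::{field,finite} \<Rightarrow> 'k::{field,finite}" and q b :: nat
  assumes "primepow q" and "b \<ge> 2"
    and "CARD('f) = q" and "CARD('k) = q ^ b" and "field_hom h"
  shows "convergent (\<lambda>c'. pcb_proportion h b c') \<and>
    (\<forall>c::nat. real c > M_bound q b \<longrightarrow>
      \<bar>pcb_proportion h b c - lim (\<lambda>c'. pcb_proportion h b c')\<bar>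
        \<le> a_J q b / (1 - real q powr (- real b)) * real q powr (- (real b * real c)))"
proof -
  let ?SS = "root_sets h b" and ?Q = "real q ^ b"
  let ?B = "(1 + real b * (16 / 3) ^ b) ^ card ?SS"
  have b: "b > 0" and card_ext: "CARD('k) = CARD('f) ^ b" using assms by simp_all
  have q: "q \<ge> 2" using card_field_gt_1[where 'k = 'f] assms(3) by simp
  have "2 ^ 2 \<le> q ^ 2" using q by (intro power_mono) auto
  also have "\<dots> \<le> q ^ b" using q assms(2) by (intro power_increasing) auto
  finally have Q4: "q ^ b \<ge> 4" by simp
  then have Q4': "?Q \<ge> 4" by (metis of_nat_le_iff of_nat_numeral of_nat_power)
  have "\<bar>pcb_proportion h b c - pcb_proportion h b c'\<bar> \<le> ?B / ?Q ^ c" if "c \<le> c'" for c c'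
    using density_prescribed_family_diff[of c c' ?SS b "{}" "{}"] that Q4 assms(4)
      disjoint_root_sets[OF assms(5) b card_ext] card_root_set[OF assms(5) b card_ext]
    by (simp add: pcb_proportion_eq[OF assms(5) b card_ext] abs_minus_commute)
  then have conv: "convergent (pcb_proportion h b)"
      "\<bar>pcb_proportion h b c - lim (pcb_proportion h b)\<bar> \<le> ?B / ?Q ^ c" for c
    using convergent_of_geometric_cauchy[of ?Q "pcb_proportion h b" ?B] Q4' by auto
  have "?B / ?Q ^ c \<le> a_J q b / (1 - real q powr (- real b)) * real q powr (- (real b * real c))" for c
  proof -
    have B: "?B \<le> a_J q b"
      using error_constant_le_a_J[OF q assms(2), of "card ?SS"]
        card_root_sets[OF assms(5) b card_ext] assms(4) by simp
    have pw: "real q powr (- real b) = 1 / ?Q" "real q powr (- (real b * real c)) = 1 / ?Q ^ c"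
      using q by (simp_all add: powr_minus powr_realpow divide_inverse flip: of_nat_mult power_mult)
    have a: "a_J q b \<ge> 0" using B by (rule order.trans[rotated]) simp
    have "a_J q b \<le> a_J q b / (1 - 1 / ?Q)"
    proof -
      have "0 < ?Q" using Q4' by linarith
      then have "1 / ?Q < 1" using Q4' by (subst divide_less_eq_1_pos) linarith+
      then show ?thesis using a mult_left_le[of "1 - 1 / ?Q" "a_J q b"] Q4' by (simp add: pos_le_divide_eq)
    qed
    then have "?B \<le> a_J q b / (1 - 1 / ?Q)" using B by linarith
    then have "?B / ?Q ^ c \<le> a_J q b / (1 - 1 / ?Q) / ?Q ^ c" by (rule divide_right_mono) simp
    then show ?thesis by (simp only: pw times_divide_eq_right mult_1_right)
  qed
  then show ?thesis using conv by (meson order.trans)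
qed

end
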